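(* For every $k,m,n,r,s\in \mathbb{N}$ such that $k\mid mnrs$ we have $$N(m,n,r,s;k)= \sum \varphi(x_3)\, \varphi(y_3)\, \varphi(z_3)\, \varphi(t_3)\, F(u,v),$$ where the sum is over all 20-tuples $$(x_1,x_2,x_3,x_4,x_5,\,y_1,y_2,y_3,y_4,y_5,\,z_1,z_2,z_3,z_4,z_5,\,t_1,t_2,t_3,t_4,t_5)\in \mathbb{N}^{20}$$ satisfying the following 11 conditions, of which (9) and (10) also define $u$ and $v$: (1) $x_1x_2x_3=m$; (2) $x_3x_4x_5=n$; (3) $y_1y_2y_3=\gcd(x_1,x_4)$; (4) $y_3y_4y_5=x_3\operatorname{lcm}(x_1,x_4)$; (5) $z_1z_2z_3=r$; (6) $z_3z_4z_5=s$; (7) $t_1t_2t_3=\gcd(z_1,z_4)$; (8) $t_3t_4t_5=z_3\operatorname{lcm}(z_1,z_4)$; (9) $\gcd(y_2,y_5)=\gcd(t_2,t_5)=:u$; (10) $y_3\operatorname{lcm}(y_2,y_5)= t_3\operatorname{lcm}(t_2,t_5)=:v$; (11) $x_1x_3x_4t_1t_3t_4=k$.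
   Context: $\mathbb{N}=\{1,2,\ldots\}$. $\mathbb{Z}_n$ denotes the additive group of residue classes modulo $n$. For $k\mid mnrs$, $N(m,n,r,s;k)$ denotes the number of subgroups of order $k$ of the group $\mathbb{Z}_m\times\mathbb{Z}_n\times\mathbb{Z}_r\times\mathbb{Z}_s$. $\varphi$ is Euler's totient function. For $u,v\in\mathbb{N}$, $F(u,v)$ denotes the number of automorphisms of the group $\mathbb{Z}_u\times\mathbb{Z}_v$. *)

theory Defs
  imports "HOL-Algebra.Algebra" "HOL-Number_Theory.Totient"
begin

(* integer_mod_group 0 is the infinite cyclic group, so the constants below have their
   intended meaning only for positive arguments. *)

definition num_subgroups :: "nat \<Rightarrow> nat \<Rightarrow> nat \<Rightarrow> nat \<Rightarrow> nat \<Rightarrow> nat" where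
  "num_subgroups m n r s k =
     card {H. subgroup H (integer_mod_group m \<times>\<times> integer_mod_group n \<times>\<times>
                          integer_mod_group r \<times>\<times> integer_mod_group s) \<and> card H = k}"

(* The elements of auto G are extensional functions on the carrier, so each automorphism
   is counted exactly once. *)

definition num_auts :: "nat \<Rightarrow> nat \<Rightarrow> nat" where
  "num_auts u v = card (auto (integer_mod_group u \<times>\<times> integer_mod_group v))"

end

theory Submission
  imports Defs
begin

text \<open>
  By Goursat's lemma a subgroup \<open>K\<close> of \<open>G \<times> H\<close> is given by its projections \<open>A\<close>, \<open>B\<close>,
  its slices \<open>N \<le> A\<close>, \<open>M \<le> B\<close> (the \<open>a\<close> with \<open>(a, 1) \<in> K\<close> and the \<open>b\<close> with \<open>(1, b) \<in> K\<close>)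
  and an isomorphism \<open>A/N \<cong> B/M\<close>, and then \<open>|K| = |A| |M|\<close>. If both quotients are isomorphic to \<open>W\<close>,
  the number of choices of the isomorphism is \<open>|Aut W|\<close>.

  For \<open>G\<close> and \<open>H\<close> cyclic the quotient is cyclic, of order \<open>x3\<close> say, which gives \<open>\<phi>(x3)\<close>
  subgroups for each choice of the slices and projections. For \<open>G = \<int>\<^sub>m \<times> \<int>\<^sub>n\<close> every
  quotient \<open>A/N\<close> has two generators, so it is \<open>\<int>\<^sub>u \<times> \<int>\<^sub>v\<close> with \<open>u dvd v\<close>, where
  \<open>v\<close> is the exponent and \<open>u v\<close> the order of \<open>A/N\<close>. Both numbers can be read off the Goursat
  parameters. So the pairs \<open>N \<le> A\<close> are counted by Goursat's lemma applied first to
  \<open>\<int>\<^sub>m \<times> \<int>\<^sub>n\<close> and then to \<open>A\<close>, and one more application, to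
  \<open>(\<int>\<^sub>m \<times> \<int>\<^sub>n) \<times> (\<int>\<^sub>r \<times> \<int>\<^sub>s)\<close>, yields the formula.
\<close>

subsection \<open>Subgroups of a direct product\<close>

text \<open>Isomorphism types of quotients are never compared directly. A finite abelian group with
  two generators has \<open>u\<close> and \<open>v\<close> fixed by its order and exponent, and both
  numbers are preserved by every isomorphism. Sums are therefore taken over arbitrary functions of
  |A|, |N| and the exponent of A/N. Such a sum does not change when A is replaced by an isomorphic
  product of two cyclic groups. This is what allows Goursat's lemma to be applied inside A, with
  gcd(x1, x4) and x3 lcm(x1, x4) in the place of m and n. The lcm's arise because the exponent of a
  subgroup of a product is the lcm of the exponents of its projections, and the exponent of a
  quotient of the product is the lcm of the exponents of the factors modulo the slices. Dividing the
  order of the quotient by y3 lcm(y2, y5) leaves gcd(y2, y5). Conditions (9) and (10) thus say that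
  A/N and B/M are isomorphic.\<close>

lemma subgroup_DirProdD:
  assumes "group G" "group H" "subgroup K (G \<times>\<times> H)"
  shows "(\<one>\<^bsub>G\<^esub>, \<one>\<^bsub>H\<^esub>) \<in> K"
    and "(a, b) \<in> K \<Longrightarrow> a \<in> carrier G \<and> b \<in> carrier H"
    and "(a, b) \<in> K \<Longrightarrow> (c, d) \<in> K \<Longrightarrow> (a \<otimes>\<^bsub>G\<^esub> c, b \<otimes>\<^bsub>H\<^esub> d) \<in> K"
    and "(a, b) \<in> K \<Longrightarrow> (inv\<^bsub>G\<^esub> a, inv\<^bsub>H\<^esub> b) \<in> K"
proof -
  show "(\<one>\<^bsub>G\<^esub>, \<one>\<^bsub>H\<^esub>) \<in> K"
    using subgroup.one_closed[OF assms(3)] by simp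
  show car: "a \<in> carrier G \<and> b \<in> carrier H" if "(a, b) \<in> K" for a b
    using subgroup.subset[OF assms(3)] that by auto
  show "(a \<otimes>\<^bsub>G\<^esub> c, b \<otimes>\<^bsub>H\<^esub> d) \<in> K" if "(a, b) \<in> K" "(c, d) \<in> K"
    using subgroup.m_closed[OF assms(3) that] by simp
  show "(inv\<^bsub>G\<^esub> a, inv\<^bsub>H\<^esub> b) \<in> K" if "(a, b) \<in> K"
    using subgroup.m_inv_closed[OF assms(3) that] assms car[OF that] by simp
qed

lemma subgroup_DirProdI:
  assumes "group G" "group H" "K \<subseteq> carrier G \<times> carrier H"
    and "(\<one>\<^bsub>G\<^esub>, \<one>\<^bsub>H\<^esub>) \<in> K"
    and "\<And>a b c d. (a, b) \<in> K \<Longrightarrow> (c, d) \<in> K \<Longrightarrow> (a \<otimes>\<^bsub>G\<^esub> c, b \<otimes>\<^bsub>H\<^esub> d) \<in> K"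
    and "\<And>a b. (a, b) \<in> K \<Longrightarrow> (inv\<^bsub>G\<^esub> a, inv\<^bsub>H\<^esub> b) \<in> K"
  shows "subgroup K (G \<times>\<times> H)"
proof (rule group.subgroupI)
  show "group (G \<times>\<times> H)" using assms by (simp add: DirProd_group)
  fix p assume p: "p \<in> K"
  obtain a b where ab: "p = (a, b)" by (cases p)
  then have "a \<in> carrier G" "b \<in> carrier H" using p assms(3) by auto
  then show "inv\<^bsub>G \<times>\<times> H\<^esub> p \<in> K" using assms p ab by simp
next
  fix p q assume "p \<in> K" "q \<in> K"
  then show "p \<otimes>\<^bsub>G \<times>\<times> H\<^esub> q \<in> K" using assms(5) by (cases p; cases q) simp
qed (use assms in auto)

lemma subgroup_converse:
  assumes "group G" "group H" "subgroup K (G \<times>\<times> H)"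
  shows "subgroup (K\<inverse>) (H \<times>\<times> G)"
  by (rule subgroup_DirProdI)
     (use assms in \<open>auto dest: subgroup_DirProdD(2-4)[OF assms]
        intro: subgroup_DirProdD(1)[OF assms]\<close>)

lemma subgroup_Domain:
  assumes "group G" "group H" "subgroup K (G \<times>\<times> H)"
  shows "subgroup (Domain K) G"
  by (rule group.subgroupI[OF assms(1)])
     (use assms in \<open>auto dest: subgroup_DirProdD(2-4)[OF assms]
        intro: subgroup_DirProdD(1)[OF assms]\<close>)

lemma subgroup_Image_one:
  assumes "group G" "group H" "subgroup K (G \<times>\<times> H)"
  shows "subgroup (K `` {\<one>\<^bsub>G\<^esub>}) H"
proof -
  interpret G: group G by fact
  interpret H: group H by fact
  show ?thesis
  proof (rule H.subgroupI)
    show "K `` {\<one>\<^bsub>G\<^esub>} \<subseteq> carrier H" using subgroup_DirProdD(2)[OF assms] by blast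
    show "K `` {\<one>\<^bsub>G\<^esub>} \<noteq> {}" using subgroup_DirProdD(1)[OF assms] by blast
    fix b assume b: "b \<in> K `` {\<one>\<^bsub>G\<^esub>}"
    then show "inv\<^bsub>H\<^esub> b \<in> K `` {\<one>\<^bsub>G\<^esub>}"
      using subgroup_DirProdD(4)[OF assms, of "\<one>\<^bsub>G\<^esub>" b] by simp
    fix c assume "c \<in> K `` {\<one>\<^bsub>G\<^esub>}"
    then show "b \<otimes>\<^bsub>H\<^esub> c \<in> K `` {\<one>\<^bsub>G\<^esub>}"
      using b subgroup_DirProdD(3)[OF assms, of "\<one>\<^bsub>G\<^esub>" b "\<one>\<^bsub>G\<^esub>" c] by simp
  qed
qed

lemma subgroup_Range:
  assumes "group G" "group H" "subgroup K (G \<times>\<times> H)"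
  shows "subgroup (Range K) H"
  using subgroup_Domain[OF assms(2,1) subgroup_converse[OF assms]] by simp

lemma subgroup_Image_converse_one:
  assumes "group G" "group H" "subgroup K (G \<times>\<times> H)"
  shows "subgroup (K\<inverse> `` {\<one>\<^bsub>H\<^esub>}) G"
  using subgroup_Image_one[OF assms(2,1) subgroup_converse[OF assms]] .

text \<open>The pairs (a, b) and (a, b') differ by a factor whose first component is 1, so the fibre
  over a is a left coset of the slice in H.\<close>

lemma subgroup_DirProd_fibre:
  assumes "group G" "group H" "subgroup K (G \<times>\<times> H)" "(a, b) \<in> K" "b' \<in> carrier H"
  shows "(a, b') \<in> K \<longleftrightarrow> inv\<^bsub>H\<^esub> b \<otimes>\<^bsub>H\<^esub> b' \<in> K `` {\<one>\<^bsub>G\<^esub>}"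
proof -
  interpret G: group G by fact
  interpret H: group H by fact
  note D = subgroup_DirProdD[OF assms(1-3)]
  have car: "a \<in> carrier G" "b \<in> carrier H" using D(2)[OF assms(4)] by auto
  show ?thesis
  proof
    assume "(a, b') \<in> K"
    then show "inv\<^bsub>H\<^esub> b \<otimes>\<^bsub>H\<^esub> b' \<in> K `` {\<one>\<^bsub>G\<^esub>}"
      using D(3)[OF D(4)[OF assms(4)], of a b'] car by simp
  next
    assume "inv\<^bsub>H\<^esub> b \<otimes>\<^bsub>H\<^esub> b' \<in> K `` {\<one>\<^bsub>G\<^esub>}"
    then have "(a \<otimes>\<^bsub>G\<^esub> \<one>\<^bsub>G\<^esub>, b \<otimes>\<^bsub>H\<^esub> (inv\<^bsub>H\<^esub> b \<otimes>\<^bsub>H\<^esub> b')) \<in> K"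
      using D(3)[OF assms(4)] by blast
    moreover have "b \<otimes>\<^bsub>H\<^esub> (inv\<^bsub>H\<^esub> b \<otimes>\<^bsub>H\<^esub> b') = b'"
      using H.inv_solve_left[of b b' "inv\<^bsub>H\<^esub> b \<otimes>\<^bsub>H\<^esub> b'"] car assms(5)
      by (metis H.inv_closed H.m_assoc H.r_inv H.l_one)
    ultimately show "(a, b') \<in> K" using car by simp
  qed
qed

text \<open>All fibres over the projection have the size of the slice, since left translation by the
  inverse of some b in the fibre maps the fibre onto the slice.\<close>

lemma card_subgroup_DirProd:
  assumes "group G" "group H" "subgroup K (G \<times>\<times> H)" "finite (carrier G)" "finite (carrier H)"
  shows "card K = card (Domain K) * card (K `` {\<one>\<^bsub>G\<^esub>})"
proof -
  interpret G: group G by fact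
  interpret H: group H by fact
  note D = subgroup_DirProdD[OF assms(1-3)]
  have K: "K = Sigma (Domain K) (\<lambda>a. K `` {a})" by auto
  have fin: "finite (Domain K)" "finite (K `` {a})" for a
    using D(2) finite_subset[OF _ assms(4), of "Domain K"]
      finite_subset[OF _ assms(5), of "K `` {a}"] by blast+
  have "card (K `` {a}) = card (K `` {\<one>\<^bsub>G\<^esub>})" if a: "a \<in> Domain K" for a
  proof -
    obtain b where b: "(a, b) \<in> K" using a by blast
    have bc: "b \<in> carrier H" using D(2)[OF b] by simp
    have "bij_betw (\<lambda>b'. inv\<^bsub>H\<^esub> b \<otimes>\<^bsub>H\<^esub> b') (K `` {a}) (K `` {\<one>\<^bsub>G\<^esub>})"
    proof (rule bij_betwI[where g = "\<lambda>c. b \<otimes>\<^bsub>H\<^esub> c"])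
      show "(\<lambda>b'. inv\<^bsub>H\<^esub> b \<otimes>\<^bsub>H\<^esub> b') \<in> K `` {a} \<rightarrow> K `` {\<one>\<^bsub>G\<^esub>}"
        using subgroup_DirProd_fibre[OF assms(1-3) b] D(2) by auto
      show "(\<lambda>c. b \<otimes>\<^bsub>H\<^esub> c) \<in> K `` {\<one>\<^bsub>G\<^esub>} \<rightarrow> K `` {a}"
        using D(3)[OF b] D(2)[OF b] by fastforce
      show "b \<otimes>\<^bsub>H\<^esub> (inv\<^bsub>H\<^esub> b \<otimes>\<^bsub>H\<^esub> x) = x" if "x \<in> K `` {a}" for x
        using that D(2)[of a x] bc by (simp add: H.m_assoc[symmetric])
      show "inv\<^bsub>H\<^esub> b \<otimes>\<^bsub>H\<^esub> (b \<otimes>\<^bsub>H\<^esub> x) = x" if "x \<in> K `` {\<one>\<^bsub>G\<^esub>}" for x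
        using that D(2)[of _ x] bc by (auto simp add: H.m_assoc[symmetric])
    qed
    then show ?thesis by (rule bij_betw_same_card)
  qed
  then have "card (Sigma (Domain K) (\<lambda>a. K `` {a})) = card (Domain K) * card (K `` {\<one>\<^bsub>G\<^esub>})"
    using fin by (subst card_SigmaI) auto
  then show ?thesis using K by simp
qed

text \<open>Together with the count over the other factor this gives |A| |M| = |B| |N|, the source
  of all equalities between the orders of the two quotients.\<close>

lemma card_subgroup_DirProd':
  assumes "group G" "group H" "subgroup K (G \<times>\<times> H)" "finite (carrier G)" "finite (carrier H)"
  shows "card K = card (Range K) * card (K\<inverse> `` {\<one>\<^bsub>H\<^esub>})"
  using card_subgroup_DirProd[OF assms(2,1) subgroup_converse[OF assms(1-3)] assms(5,4)] by simp

section \<open>Exponents of quotients under Goursat's correspondence\<close>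

lemma subgroup_DirProd_pow:
  assumes "group G" "group H" "subgroup K (G \<times>\<times> H)" "(a, b) \<in> K"
  shows "(a [^]\<^bsub>G\<^esub> (t::nat), b [^]\<^bsub>H\<^esub> t) \<in> K"
  by (induction t) (use subgroup_DirProdD[OF assms(1-3)] assms(4) in auto)

text \<open>For \<open>N\<close> normal in \<open>A\<close> this says that \<open>e\<close> is the exponent of \<open>A/N\<close>.\<close>

definition relative_exponent :: "('a, 'm) monoid_scheme \<Rightarrow> 'a set \<Rightarrow> 'a set \<Rightarrow> nat \<Rightarrow> bool" where
  "relative_exponent G A N e \<longleftrightarrow> (\<forall>t::nat. (\<forall>a\<in>A. a [^]\<^bsub>G\<^esub> t \<in> N) \<longleftrightarrow> e dvd t)"

lemma relative_exponent_unique: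
  "relative_exponent G A N e \<Longrightarrow> relative_exponent G A N e' \<Longrightarrow> e = e'"
  unfolding relative_exponent_def by (metis dvd_antisym dvd_refl)

text \<open>A pair (a, b) in \<open>K\<close> has its power (a^t, b^t) in \<open>K\<close>. If (a^t,
  1) is there too, then both lie in one fibre, and b^t is in the slice.\<close>

lemma Goursat_pow_kernel:
  assumes "group G" "group H" "subgroup K (G \<times>\<times> H)"
    and "\<forall>a\<in>Domain K. a [^]\<^bsub>G\<^esub> (t::nat) \<in> K\<inverse> `` {\<one>\<^bsub>H\<^esub>}" "b \<in> Range K"
  shows "b [^]\<^bsub>H\<^esub> t \<in> K `` {\<one>\<^bsub>G\<^esub>}"
proof -
  note D = subgroup_DirProdD[OF assms(1-3)]
  interpret G: group G by fact
  interpret H: group H by fact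
  obtain a where a: "(a, b) \<in> K" using assms(5) by blast
  have "(a [^]\<^bsub>G\<^esub> t, \<one>\<^bsub>H\<^esub>) \<in> K" using assms(4) a by blast
  moreover have ab: "(a [^]\<^bsub>G\<^esub> t, b [^]\<^bsub>H\<^esub> t) \<in> K"
    by (rule subgroup_DirProd_pow[OF assms(1-3) a])
  ultimately show ?thesis
    using subgroup_DirProd_fibre[OF assms(1-3), of "a [^]\<^bsub>G\<^esub> t" "\<one>\<^bsub>H\<^esub>" "b [^]\<^bsub>H\<^esub> t"] D(2)[OF ab]
    by simp
qed

text \<open>Of the isomorphism between the two quotients only the equality of exponents is needed,
  and the power argument for \<open>K\<close> and for its converse gives it directly.\<close>

lemma relative_exponent_Goursat:
  assumes "group G" "group H" "subgroup K (G \<times>\<times> H)"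
    and "relative_exponent G (Domain K) (K\<inverse> `` {\<one>\<^bsub>H\<^esub>}) e"
  shows "relative_exponent H (Range K) (K `` {\<one>\<^bsub>G\<^esub>}) e"
proof -
  have "(\<forall>a\<in>Domain K. a [^]\<^bsub>G\<^esub> t \<in> K\<inverse> `` {\<one>\<^bsub>H\<^esub>}) \<longleftrightarrow>
        (\<forall>b\<in>Range K. b [^]\<^bsub>H\<^esub> t \<in> K `` {\<one>\<^bsub>G\<^esub>})" for t :: nat
    using Goursat_pow_kernel[OF assms(1-3), of t]
      Goursat_pow_kernel[OF assms(2,1) subgroup_converse[OF assms(1-3)], of t]
    by auto
  then show ?thesis using assms(4) unfolding relative_exponent_def by simp
qed

text \<open>Working with epimorphisms \<open>A \<rightarrow> W\<close> with kernel \<open>N\<close> instead of isomorphisms \<open>A/N \<cong> W\<close>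
  avoids cosets.\<close>

definition quotient_map ::
    "('a, 'm) monoid_scheme \<Rightarrow> 'a set \<Rightarrow> 'a set \<Rightarrow> ('w, 'n) monoid_scheme \<Rightarrow> ('a \<Rightarrow> 'w) \<Rightarrow> bool" where
  "quotient_map G A N W \<alpha> \<longleftrightarrow>
     (\<forall>x\<in>A. \<forall>y\<in>A. \<alpha> (x \<otimes>\<^bsub>G\<^esub> y) = \<alpha> x \<otimes>\<^bsub>W\<^esub> \<alpha> y) \<and>
     \<alpha> ` A = carrier W \<and> {x \<in> A. \<alpha> x = \<one>\<^bsub>W\<^esub>} = N"

lemma quotient_mapD:
  assumes "group G" "group W" "subgroup A G" "quotient_map G A N W \<alpha>"
  shows "x \<in> A \<Longrightarrow> y \<in> A \<Longrightarrow> \<alpha> (x \<otimes>\<^bsub>G\<^esub> y) = \<alpha> x \<otimes>\<^bsub>W\<^esub> \<alpha> y"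
    and "\<alpha> ` A = carrier W"
    and "x \<in> A \<Longrightarrow> \<alpha> x \<in> carrier W"
    and "x \<in> A \<Longrightarrow> x \<in> N \<longleftrightarrow> \<alpha> x = \<one>\<^bsub>W\<^esub>"
    and "\<alpha> \<one>\<^bsub>G\<^esub> = \<one>\<^bsub>W\<^esub>"
    and "x \<in> A \<Longrightarrow> \<alpha> (inv\<^bsub>G\<^esub> x) = inv\<^bsub>W\<^esub> (\<alpha> x)"
    and "x \<in> A \<Longrightarrow> \<alpha> (x [^]\<^bsub>G\<^esub> (t::nat)) = \<alpha> x [^]\<^bsub>W\<^esub> t"
    and "N \<subseteq> A"
    and "x \<in> A \<Longrightarrow> y \<in> A \<Longrightarrow> \<alpha> x = \<alpha> y \<longleftrightarrow> inv\<^bsub>G\<^esub> x \<otimes>\<^bsub>G\<^esub> y \<in> N"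
proof -
  interpret G: group G by fact
  interpret W: group W by fact
  interpret A: subgroup A G by fact
  show m: "\<alpha> (x \<otimes>\<^bsub>G\<^esub> y) = \<alpha> x \<otimes>\<^bsub>W\<^esub> \<alpha> y" if "x \<in> A" "y \<in> A" for x y
    using assms(4) that unfolding quotient_map_def by blast
  show im: "\<alpha> ` A = carrier W" using assms(4) unfolding quotient_map_def by blast
  then show c: "\<alpha> x \<in> carrier W" if "x \<in> A" for x using that by blast
  show n: "x \<in> N \<longleftrightarrow> \<alpha> x = \<one>\<^bsub>W\<^esub>" if "x \<in> A" for x
    using assms(4) that unfolding quotient_map_def by blast
  have "\<alpha> \<one>\<^bsub>G\<^esub> \<otimes>\<^bsub>W\<^esub> \<alpha> \<one>\<^bsub>G\<^esub> = \<alpha> \<one>\<^bsub>G\<^esub>" using m[of "\<one>\<^bsub>G\<^esub>" "\<one>\<^bsub>G\<^esub>"] by simp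
  then show o: "\<alpha> \<one>\<^bsub>G\<^esub> = \<one>\<^bsub>W\<^esub>" using c[of "\<one>\<^bsub>G\<^esub>"] by simp
  show i: "\<alpha> (inv\<^bsub>G\<^esub> x) = inv\<^bsub>W\<^esub> (\<alpha> x)" if "x \<in> A" for x
  proof (rule W.inv_equality[symmetric])
    show "\<alpha> (inv\<^bsub>G\<^esub> x) \<otimes>\<^bsub>W\<^esub> \<alpha> x = \<one>\<^bsub>W\<^esub>"
      using m[of "inv\<^bsub>G\<^esub> x" x] that o A.subset by (auto simp: subset_iff)
  qed (use that c in auto)
  show "\<alpha> (x [^]\<^bsub>G\<^esub> (t::nat)) = \<alpha> x [^]\<^bsub>W\<^esub> t" if "x \<in> A"
  proof (induction t)
    case (Suc t)
    have "x [^]\<^bsub>G\<^esub> t \<in> A"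
      using G.subgroupE[OF assms(3)] by (induction t) (use that in auto)
    then show ?case using Suc m that by simp
  qed (simp add: o)
  show "N \<subseteq> A" using assms(4) unfolding quotient_map_def by blast
  show "\<alpha> x = \<alpha> y \<longleftrightarrow> inv\<^bsub>G\<^esub> x \<otimes>\<^bsub>G\<^esub> y \<in> N" if xy: "x \<in> A" "y \<in> A"
  proof -
    have "inv\<^bsub>G\<^esub> x \<otimes>\<^bsub>G\<^esub> y \<in> N \<longleftrightarrow> inv\<^bsub>W\<^esub> (\<alpha> x) \<otimes>\<^bsub>W\<^esub> \<alpha> y = \<one>\<^bsub>W\<^esub>"
      using n[of "inv\<^bsub>G\<^esub> x \<otimes>\<^bsub>G\<^esub> y"] m i xy by simp
    also have "\<dots> \<longleftrightarrow> \<alpha> x = \<alpha> y"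
      using c xy by (metis W.inv_closed W.inv_equality W.inv_inv W.l_inv)
    finally show ?thesis by simp
  qed
qed

subsection \<open>Goursat's lemma for a fixed quotient\<close>

text \<open>With both projections and both slices prescribed, only the isomorphism between the
  quotients is left free. Every subgroup of the product lies in exactly one such class.\<close>

definition Goursat_class :: "('a, 'm) monoid_scheme \<Rightarrow> ('b, 'n) monoid_scheme \<Rightarrow>
    'a set \<Rightarrow> 'a set \<Rightarrow> 'b set \<Rightarrow> 'b set \<Rightarrow> ('a \<times> 'b) set set" where
  "Goursat_class G H A N B M =
     {K. subgroup K (G \<times>\<times> H) \<and> Domain K = A \<and> K\<inverse> `` {\<one>\<^bsub>H\<^esub>} = N \<and>
         Range K = B \<and> K `` {\<one>\<^bsub>G\<^esub>} = M}"

text \<open>This is the fibre product of \<open>\<theta> \<circ> \<alpha>\<close> and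
  \<open>\<beta>\<close> over W.\<close>

definition Goursat_graph :: "'a set \<Rightarrow> ('a \<Rightarrow> 'w) \<Rightarrow> 'b set \<Rightarrow> ('b \<Rightarrow> 'w) \<Rightarrow> ('w \<Rightarrow> 'w) \<Rightarrow> ('a \<times> 'b) set" where
  "Goursat_graph A \<alpha> B \<beta> \<theta> = {(a, b). a \<in> A \<and> b \<in> B \<and> \<theta> (\<alpha> a) = \<beta> b}"

lemma autoD:
  assumes "group W" "\<theta> \<in> auto W"
  shows "w \<in> carrier W \<Longrightarrow> \<theta> w \<in> carrier W"
    and "w \<in> carrier W \<Longrightarrow> w' \<in> carrier W \<Longrightarrow> \<theta> (w \<otimes>\<^bsub>W\<^esub> w') = \<theta> w \<otimes>\<^bsub>W\<^esub> \<theta> w'"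
    and "\<theta> \<one>\<^bsub>W\<^esub> = \<one>\<^bsub>W\<^esub>"
    and "w \<in> carrier W \<Longrightarrow> \<theta> (inv\<^bsub>W\<^esub> w) = inv\<^bsub>W\<^esub> (\<theta> w)"
    and "inj_on \<theta> (carrier W)" and "\<theta> ` carrier W = carrier W"
    and "\<theta> \<in> extensional (carrier W)"
proof -
  interpret group_hom W W \<theta>
    using assms by (simp add: group_hom_def group_hom_axioms_def auto_def)
  show "w \<in> carrier W \<Longrightarrow> \<theta> w \<in> carrier W"
    and "w \<in> carrier W \<Longrightarrow> w' \<in> carrier W \<Longrightarrow> \<theta> (w \<otimes>\<^bsub>W\<^esub> w') = \<theta> w \<otimes>\<^bsub>W\<^esub> \<theta> w'"
    and "\<theta> \<one>\<^bsub>W\<^esub> = \<one>\<^bsub>W\<^esub>"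
    and "w \<in> carrier W \<Longrightarrow> \<theta> (inv\<^bsub>W\<^esub> w) = inv\<^bsub>W\<^esub> (\<theta> w)" by simp_all
  show "inj_on \<theta> (carrier W)" "\<theta> ` carrier W = carrier W" "\<theta> \<in> extensional (carrier W)"
    using assms by (auto simp: auto_def Bij_def bij_betw_def)
qed

text \<open>Surjectivity of \<open>\<beta>\<close> gives every element of A a partner, surjectivity
  of \<open>\<theta>\<close> and \<open>\<alpha>\<close> every element of B. The slices are the
  kernels of \<open>\<theta> \<circ> \<alpha>\<close> and \<open>\<beta>\<close>, and the first is N
  because \<open>\<theta>\<close> is injective.\<close>

lemma Goursat_graph_in_class:
  assumes "group G" "group H" "group W" "subgroup A G" "subgroup B H"
    and "quotient_map G A N W \<alpha>" "quotient_map H B M W \<beta>" "\<theta> \<in> auto W"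
  shows "Goursat_graph A \<alpha> B \<beta> \<theta> \<in> Goursat_class G H A N B M"
proof -
  interpret G: group G by fact
  interpret H: group H by fact
  interpret A: subgroup A G by fact
  interpret B: subgroup B H by fact
  note a = quotient_mapD[OF assms(1,3,4,6)]
  note b = quotient_mapD[OF assms(2,3,5,7)]
  note t = autoD[OF assms(3,8)]
  let ?K = "Goursat_graph A \<alpha> B \<beta> \<theta>"
  have "subgroup ?K (G \<times>\<times> H)"
  proof (rule subgroup_DirProdI[OF assms(1,2)])
    show "?K \<subseteq> carrier G \<times> carrier H"
      using A.subset B.subset by (auto simp: Goursat_graph_def)
    show "(\<one>\<^bsub>G\<^esub>, \<one>\<^bsub>H\<^esub>) \<in> ?K"
      using a(5) b(5) t(3) by (simp add: Goursat_graph_def)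
    show "(x \<otimes>\<^bsub>G\<^esub> z, y \<otimes>\<^bsub>H\<^esub> w) \<in> ?K" if "(x, y) \<in> ?K" "(z, w) \<in> ?K" for x y z w
      using that a(1,3) b(1) t(2) by (simp add: Goursat_graph_def)
    show "(inv\<^bsub>G\<^esub> x, inv\<^bsub>H\<^esub> y) \<in> ?K" if "(x, y) \<in> ?K" for x y
      using that a(6,3) b(6) t(4) by (simp add: Goursat_graph_def)
  qed
  moreover have "Domain ?K = A"
  proof
    show "A \<subseteq> Domain ?K"
    proof
      fix x assume x: "x \<in> A"
      then have "\<theta> (\<alpha> x) \<in> \<beta> ` B" using a(3) t(1) b(2) by simp
      then show "x \<in> Domain ?K" using x by (auto simp: Goursat_graph_def)
    qed
  qed (auto simp: Goursat_graph_def)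
  moreover have "Range ?K = B"
  proof
    show "B \<subseteq> Range ?K"
    proof
      fix y assume y: "y \<in> B"
      then have "\<beta> y \<in> \<theta> ` (\<alpha> ` A)" using b(3) t(6) a(2) by simp
      then show "y \<in> Range ?K" using y by (auto simp: Goursat_graph_def)
    qed
  qed (auto simp: Goursat_graph_def)
  moreover have "?K\<inverse> `` {\<one>\<^bsub>H\<^esub>} = N"
  proof -
    have "\<theta> w = \<one>\<^bsub>W\<^esub> \<longleftrightarrow> w = \<one>\<^bsub>W\<^esub>" if "w \<in> carrier W" for w
      using t(3) inj_onD[OF t(5), of w "\<one>\<^bsub>W\<^esub>"] that assms(3) by (auto simp: group.is_monoid monoid.one_closed)
    moreover have "N = {x \<in> A. \<alpha> x = \<one>\<^bsub>W\<^esub>}" using assms(6) by (simp add: quotient_map_def)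
    ultimately show ?thesis using a(3) b(5) t(3) subgroup.one_closed[OF assms(5)]
      by (auto simp: Goursat_graph_def)
  qed
  moreover have "?K `` {\<one>\<^bsub>G\<^esub>} = M"
    using a(5) t(3) assms(7) subgroup.one_closed[OF assms(4)]
    by (auto simp: Goursat_graph_def quotient_map_def)
  ultimately show ?thesis unfolding Goursat_class_def by blast
qed

lemma Goursat_graph_inj:
  assumes "group G" "group H" "group W" "subgroup A G" "subgroup B H"
    and "quotient_map G A N W \<alpha>" "quotient_map H B M W \<beta>"
  shows "inj_on (Goursat_graph A \<alpha> B \<beta>) (auto W)"
proof (rule inj_onI)
  note a = quotient_mapD[OF assms(1,3,4,6)]
  note b = quotient_mapD[OF assms(2,3,5,7)]
  fix \<theta> \<eta> assume th: "\<theta> \<in> auto W" "\<eta> \<in> auto W"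
    and eq: "Goursat_graph A \<alpha> B \<beta> \<theta> = Goursat_graph A \<alpha> B \<beta> \<eta>"
  show "\<theta> = \<eta>"
  proof (rule extensionalityI[OF autoD(7)[OF assms(3) th(1)] autoD(7)[OF assms(3) th(2)]])
    fix w assume w: "w \<in> carrier W"
    then have "w \<in> \<alpha> ` A" using a(2) by simp
    then obtain x where x: "x \<in> A" "\<alpha> x = w" by blast
    have "\<theta> w \<in> carrier W" using autoD(1)[OF assms(3) th(1) w] .
    then have "\<theta> w \<in> \<beta> ` B" using b(2) by simp
    then obtain y where y: "y \<in> B" "\<beta> y = \<theta> w" by (metis imageE)
    then have "(x, y) \<in> Goursat_graph A \<alpha> B \<beta> \<theta>" using x by (simp add: Goursat_graph_def)
    then have "(x, y) \<in> Goursat_graph A \<alpha> B \<beta> \<eta>" using eq by simp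
    then show "\<theta> w = \<eta> w" using x y by (simp add: Goursat_graph_def)
  qed
qed

text \<open>The assignment of \<open>\<beta> b\<close> to \<open>\<alpha> a\<close> is well defined
  by one direction and injective by the other. Both hold because the quotient of the two pairs lies
  in \<open>K\<close>, so that its first component is in N exactly when its second is in M.\<close>

lemma Goursat_class_eq_iff:
  assumes "group G" "group H" "group W" "subgroup A G" "subgroup B H"
    and "quotient_map G A N W \<alpha>" "quotient_map H B M W \<beta>"
    and "K \<in> Goursat_class G H A N B M" "(a, b) \<in> K" "(a', b') \<in> K"
  shows "\<alpha> a = \<alpha> a' \<longleftrightarrow> \<beta> b = \<beta> b'"
proof -
  interpret G: group G by fact
  interpret H: group H by fact
  have K: "subgroup K (G \<times>\<times> H)" "Domain K = A" "K\<inverse> `` {\<one>\<^bsub>H\<^esub>} = N" "Range K = B" "K `` {\<one>\<^bsub>G\<^esub>} = M"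
    using assms(8) by (auto simp: Goursat_class_def)
  note D = subgroup_DirProdD[OF assms(1,2) K(1)]
  have in_sets: "a \<in> A" "a' \<in> A" "b \<in> B" "b' \<in> B" using K assms(9,10) by auto
  have p: "(inv\<^bsub>G\<^esub> a \<otimes>\<^bsub>G\<^esub> a', inv\<^bsub>H\<^esub> b \<otimes>\<^bsub>H\<^esub> b') \<in> K"
    using D(3)[OF D(4)[OF assms(9)] assms(10)] .
  have "inv\<^bsub>G\<^esub> a \<otimes>\<^bsub>G\<^esub> a' \<in> N \<longleftrightarrow> inv\<^bsub>H\<^esub> b \<otimes>\<^bsub>H\<^esub> b' \<in> M"
  proof
    assume "inv\<^bsub>G\<^esub> a \<otimes>\<^bsub>G\<^esub> a' \<in> N"
    then have "(inv\<^bsub>G\<^esub> a \<otimes>\<^bsub>G\<^esub> a', \<one>\<^bsub>H\<^esub>) \<in> K" using K(3) by blast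
    then show "inv\<^bsub>H\<^esub> b \<otimes>\<^bsub>H\<^esub> b' \<in> M"
      using subgroup_DirProd_fibre[OF assms(1,2) K(1), of "inv\<^bsub>G\<^esub> a \<otimes>\<^bsub>G\<^esub> a'" "\<one>\<^bsub>H\<^esub>" "inv\<^bsub>H\<^esub> b \<otimes>\<^bsub>H\<^esub> b'"]
        D(2)[OF p] p K(5) by simp
  next
    assume "inv\<^bsub>H\<^esub> b \<otimes>\<^bsub>H\<^esub> b' \<in> M"
    then have "(\<one>\<^bsub>G\<^esub>, inv\<^bsub>H\<^esub> b \<otimes>\<^bsub>H\<^esub> b') \<in> K" using K(5) by blast
    then show "inv\<^bsub>G\<^esub> a \<otimes>\<^bsub>G\<^esub> a' \<in> N"
      using subgroup_DirProd_fibre[OF assms(2,1) subgroup_converse[OF assms(1,2) K(1)],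
          of "inv\<^bsub>H\<^esub> b \<otimes>\<^bsub>H\<^esub> b'" "\<one>\<^bsub>G\<^esub>" "inv\<^bsub>G\<^esub> a \<otimes>\<^bsub>G\<^esub> a'"]
        D(2)[OF p] p K(3) by simp
  qed
  then show ?thesis
    using quotient_mapD(9)[OF assms(1,3,4,6)] quotient_mapD(9)[OF assms(2,3,5,7)] in_sets by simp
qed

lemma Goursat_class_graph:
  assumes "group G" "group H" "group W" "subgroup A G" "subgroup B H"
    and "quotient_map G A N W \<alpha>" "quotient_map H B M W \<beta>"
    and "K \<in> Goursat_class G H A N B M"
  shows "\<exists>\<theta>\<in>auto W. K = Goursat_graph A \<alpha> B \<beta> \<theta>"
proof -
  interpret W: group W by fact
  have K: "subgroup K (G \<times>\<times> H)" "Domain K = A" "K\<inverse> `` {\<one>\<^bsub>H\<^esub>} = N" "Range K = B" "K `` {\<one>\<^bsub>G\<^esub>} = M"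
    using assms(8) by (auto simp: Goursat_class_def)
  note D = subgroup_DirProdD[OF assms(1,2) K(1)]
  note a = quotient_mapD[OF assms(1,3,4,6)]
  note b = quotient_mapD[OF assms(2,3,5,7)]
  note eq = Goursat_class_eq_iff[OF assms]
  have mem: "x \<in> A" "y \<in> B" if "(x, y) \<in> K" for x y using K that by auto
  \<comment> \<open>The choice is harmless, since all admissible values agree by \<open>eq\<close>.
    Restricting to the carrier makes the map extensional, as \<open>auto\<close> demands.\<close>
  define \<theta> where "\<theta> = (\<lambda>w\<in>carrier W. SOME v. \<exists>x y. (x, y) \<in> K \<and> \<alpha> x = w \<and> \<beta> y = v)"
  have \<theta>: "\<theta> (\<alpha> x) = \<beta> y" if xy: "(x, y) \<in> K" for x y
  proof -
    have "(SOME v. \<exists>x' y'. (x', y') \<in> K \<and> \<alpha> x' = \<alpha> x \<and> \<beta> y' = v) = \<beta> y"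
      by (rule some_equality) (use xy eq in blast)+
    then show ?thesis using a(3) mem[OF xy] by (simp add: \<theta>_def)
  qed
  have ex: "\<exists>x y. (x, y) \<in> K \<and> w = \<alpha> x \<and> \<theta> w = \<beta> y" if "w \<in> carrier W" for w
  proof -
    have "w \<in> \<alpha> ` A" using that a(2) by simp
    then obtain x where "x \<in> A" "\<alpha> x = w" by blast
    then obtain y where "(x, y) \<in> K" using K(2) by blast
    then show ?thesis using \<theta> \<open>\<alpha> x = w\<close> by blast
  qed
  have "\<theta> \<in> hom W W"
  proof (rule homI)
    fix w assume "w \<in> carrier W"
    then show "\<theta> w \<in> carrier W" using ex[of w] b(3) mem by force
  next
    fix w v assume wv: "w \<in> carrier W" "v \<in> carrier W"
    obtain x y where xy: "(x, y) \<in> K" "w = \<alpha> x" "\<theta> w = \<beta> y" using ex[OF wv(1)] by blast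
    obtain x' y' where xy': "(x', y') \<in> K" "v = \<alpha> x'" "\<theta> v = \<beta> y'" using ex[OF wv(2)] by blast
    have "\<theta> (\<alpha> (x \<otimes>\<^bsub>G\<^esub> x')) = \<beta> (y \<otimes>\<^bsub>H\<^esub> y')" using \<theta> D(3)[OF xy(1) xy'(1)] .
    then show "\<theta> (w \<otimes>\<^bsub>W\<^esub> v) = \<theta> w \<otimes>\<^bsub>W\<^esub> \<theta> v"
      using a(1) b(1) mem xy xy' by metis
  qed
  moreover have "bij_betw \<theta> (carrier W) (carrier W)"
  proof (rule bij_betw_imageI)
    show "inj_on \<theta> (carrier W)"
    proof (rule inj_onI)
      fix w v assume wv: "w \<in> carrier W" "v \<in> carrier W" "\<theta> w = \<theta> v"
      show "w = v" using ex[OF wv(1)] ex[OF wv(2)] wv(3) eq by metis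
    qed
    show "\<theta> ` carrier W = carrier W"
    proof
      show "\<theta> ` carrier W \<subseteq> carrier W" using ex b(3) mem by force
      show "carrier W \<subseteq> \<theta> ` carrier W"
      proof
        fix v assume "v \<in> carrier W"
        then have "v \<in> \<beta> ` B" using b(2) by simp
        then obtain y where "y \<in> B" "\<beta> y = v" by blast
        then obtain x where "(x, y) \<in> K" using K(4) by blast
        then show "v \<in> \<theta> ` carrier W" using \<theta> \<open>\<beta> y = v\<close> a(3) mem by (metis imageI)
      qed
    qed
  qed
  moreover have "\<theta> \<in> extensional (carrier W)" by (simp add: \<theta>_def)
  ultimately have auto: "\<theta> \<in> auto W" by (simp add: auto_def Bij_def)
  have "K = Goursat_graph A \<alpha> B \<beta> \<theta>"
  proof (intro equalityI subrelI)
    fix x y assume "(x, y) \<in> K"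
    then show "(x, y) \<in> Goursat_graph A \<alpha> B \<beta> \<theta>" using mem \<theta> by (simp add: Goursat_graph_def)
  next
    fix x y assume "(x, y) \<in> Goursat_graph A \<alpha> B \<beta> \<theta>"
    then have xy: "x \<in> A" "y \<in> B" "\<theta> (\<alpha> x) = \<beta> y" by (auto simp: Goursat_graph_def)
    \<comment> \<open>A second partner of x is compared with y: both have the same image under
      \<open>\<beta>\<close>, so they differ by an element of M, and y lies in the fibre of
      \<open>K\<close> over x.\<close>
    obtain y' where y': "(x, y') \<in> K" using xy K(2) by blast
    then have "\<beta> y' = \<beta> y" using \<theta> xy by simp
    then have "inv\<^bsub>H\<^esub> y' \<otimes>\<^bsub>H\<^esub> y \<in> M" using b(9) xy mem y' by blast
    then show "(x, y) \<in> K"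
      using subgroup_DirProd_fibre[OF assms(1,2) K(1) y'] subgroup.mem_carrier[OF assms(5) xy(2)] K(5)
      by blast
  qed
  then show ?thesis using auto by blast
qed

theorem card_Goursat_class:
  assumes "group G" "group H" "group W" "subgroup A G" "subgroup B H"
    and "quotient_map G A N W \<alpha>" "quotient_map H B M W \<beta>"
  shows "card (Goursat_class G H A N B M) = card (auto W)"
proof -
  have "bij_betw (Goursat_graph A \<alpha> B \<beta>) (auto W) (Goursat_class G H A N B M)"
    using Goursat_graph_inj[OF assms] Goursat_graph_in_class[OF assms] Goursat_class_graph[OF assms]
    by (auto intro!: bij_betw_imageI)
  then show ?thesis by (simp add: bij_betw_same_card)
qed

subsection \<open>Abelian groups with two generators\<close>

definition pair_generates :: "('a, 'm) monoid_scheme \<Rightarrow> 'a set \<Rightarrow> 'a \<Rightarrow> 'a \<Rightarrow> bool" where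
  "pair_generates G A a b \<longleftrightarrow> a \<in> A \<and> b \<in> A \<and> (\<forall>x\<in>A. \<exists>(i::int) (j::int). x = a [^]\<^bsub>G\<^esub> i \<otimes>\<^bsub>G\<^esub> b [^]\<^bsub>G\<^esub> j)"

context comm_group
begin

text \<open>Exponent vectors are multiplied by the matrix with rows (i, j) and (k, l). A unimodular
  matrix thus gives a change of generators.\<close>

lemma int_pow_combination:
  fixes i j k l m n :: int
  assumes "a \<in> carrier G" "b \<in> carrier G"
  shows "(a [^] i \<otimes> b [^] j) [^] m \<otimes> (a [^] k \<otimes> b [^] l) [^] n =
         a [^] (i * m + k * n) \<otimes> b [^] (j * m + l * n)"
  using assms by (simp add: int_pow_distrib int_pow_pow int_pow_mult m_ac)

text \<open>Dividing the relation by d = gcd(i, j) gives a primitive vector (i', j'), which Bezout's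
  identity completes to a matrix of determinant 1 with second row (-v, u). The new first generator
  is then annihilated by d.\<close>

lemma pair_generates_relation:
  fixes i j :: int
  assumes gen: "pair_generates G (carrier G) a b"
    and rel: "a [^] i \<otimes> b [^] j = \<one>" and nz: "i \<noteq> 0 \<or> j \<noteq> 0"
  shows "\<exists>a' b'. pair_generates G (carrier G) a' b' \<and> int (ord a') dvd gcd i j"
proof -
  have ab: "a \<in> carrier G" "b \<in> carrier G"
    and all: "\<And>x. x \<in> carrier G \<Longrightarrow> \<exists>(k::int) (l::int). x = a [^] k \<otimes> b [^] l"
    using gen by (auto simp: pair_generates_def)
  define d where "d = gcd i j"
  have d: "d \<noteq> 0" using nz by (auto simp: d_def)
  obtain i' j' where ij: "i = d * i'" "j = d * j'" unfolding d_def by (meson gcd_dvd1 gcd_dvd2 dvdE)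
  obtain u v where "u * i + v * j = d" using bezout_int[of i j] d_def by blast
  then have "d * (u * i' + v * j') = d * 1" using ij by (simp add: algebra_simps)
  then have uv: "u * i' + v * j' = 1" using d by simp
  define a' where "a' = a [^] i' \<otimes> b [^] j'"
  define b' where "b' = a [^] (- v) \<otimes> b [^] u"
  have "pair_generates G (carrier G) a' b'"
    unfolding pair_generates_def
  proof (intro conjI ballI)
    show "a' \<in> carrier G" "b' \<in> carrier G" using ab by (auto simp: a'_def b'_def)
    fix x assume "x \<in> carrier G"
    then obtain k l :: int where x: "x = a [^] k \<otimes> b [^] l" using all by blast
    \<comment> \<open>The row (k, l) times the inverse of the matrix of the new generators.\<close>
    define m n where "m = u * k + v * l" and "n = i' * l - j' * k"
    have "i' * m + - v * n = (u * i' + v * j') * k" "j' * m + u * n = (u * i' + v * j') * l"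
      by (simp_all add: m_def n_def algebra_simps)
    then have "a' [^] m \<otimes> b' [^] n = x"
      unfolding a'_def b'_def int_pow_combination[OF ab] x by (simp add: uv)
    then show "\<exists>(i::int) (j::int). x = a' [^] i \<otimes> b' [^] j" by metis
  qed
  moreover have "a' [^] d = \<one>"
    using rel ab by (simp add: a'_def int_pow_distrib int_pow_pow ij mult.commute)
  then have "int (ord a') dvd gcd i j"
    using int_pow_eq_id[of a' d] ab by (simp add: a'_def d_def)
  ultimately show ?thesis by blast
qed

text \<open>A generating pair with \<open>ord a\<close> minimal works: a nontrivial relation between \<open>a\<close> and \<open>b\<close>
  would give a unimodular change of generators that lowers \<open>ord a\<close>.\<close>

lemma independent_generating_pair:
  assumes fin: "finite (carrier G)" and gen: "pair_generates G (carrier G) a0 b0"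
  shows "\<exists>a b. pair_generates G (carrier G) a b \<and> ord a dvd ord b \<and>
           (\<forall>(i::int) (j::int). a [^] i \<otimes> b [^] j = \<one> \<longrightarrow> int (ord a) dvd i \<and> int (ord b) dvd j)"
proof -
  let ?P = "\<lambda>c. pair_generates G (carrier G) (fst c) (snd c)"
  have "?P (a0, b0)" using gen by simp
  from ex_has_least_nat[of ?P, OF this, of "\<lambda>c. ord (fst c)"]
  obtain ab where ab: "?P ab" and least: "\<And>c. ?P c \<Longrightarrow> ord (fst ab) \<le> ord (fst c)"
    by blast
  define a b where "a = fst ab" and "b = snd ab"
  have g: "pair_generates G (carrier G) a b" using ab by (simp add: a_def b_def)
  then have car: "a \<in> carrier G" "b \<in> carrier G" by (auto simp: pair_generates_def)
  have pos: "ord a > 0" "ord b > 0" using ord_ge_1[OF fin] car by force+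
  have min: "int (ord a) \<le> gcd i j" if rel: "a [^] i \<otimes> b [^] j = \<one>" and nz: "i \<noteq> 0 \<or> j \<noteq> 0" for i j :: int
  proof -
    obtain a' b' where a': "pair_generates G (carrier G) a' b'" "int (ord a') dvd gcd i j"
      using pair_generates_relation[OF g rel nz] by blast
    have "int (ord a) \<le> int (ord a')" using least[of "(a', b')"] a' by (simp add: a_def)
    moreover have "int (ord a') \<le> gcd i j" using zdvd_imp_le[OF a'(2)] nz gcd_pos_int by blast
    ultimately show ?thesis by linarith
  qed
  have powo: "a [^] int (ord a) = \<one>" "b [^] int (ord b) = \<one>"
    using car by (simp_all add: int_pow_int)
  \<comment> \<open>The minimality bound applied to the obvious relation, in which both generators
    are raised to their orders, forces \<open>ord a\<close> to divide \<open>ord b\<close>.\<close>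
  have "int (ord a) \<le> gcd (int (ord a)) (int (ord b))"
    using min[of "int (ord a)" "int (ord b)"] powo pos car by simp
  then have "ord a \<le> gcd (ord a) (ord b)" by simp
  moreover have "gcd (ord a) (ord b) \<le> ord a" using pos by (intro dvd_imp_le) auto
  ultimately have "gcd (ord a) (ord b) = ord a" by linarith
  then have dvd: "ord a dvd ord b" by (metis gcd_dvd2)
  have "int (ord a) dvd i \<and> int (ord b) dvd j" if rel: "a [^] i \<otimes> b [^] j = \<one>" for i j :: int
  proof -
    have ai: "a [^] (i mod int (ord a)) = a [^] i"
      using car by (simp add: int_pow_eq dvd_minus_mod)
    \<comment> \<open>A nonzero remainder would be the exponent of a in a relation whose gcd is
      smaller than \<open>ord a\<close>.\<close>
    have "i mod int (ord a) = 0"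
    proof (rule ccontr)
      assume nz: "i mod int (ord a) \<noteq> 0"
      then have "int (ord a) \<le> gcd (i mod int (ord a)) j" using min[of "i mod int (ord a)" j] rel ai by simp
      moreover have "gcd (i mod int (ord a)) j \<le> i mod int (ord a)"
        using nz pos_mod_sign[of "int (ord a)" i] pos by (intro gcd_le1_int) linarith
      moreover have "i mod int (ord a) < int (ord a)" using pos by simp
      ultimately show False by linarith
    qed
    then have i: "int (ord a) dvd i" by presburger
    then have "a [^] i = \<one>" using car int_pow_eq_id by blast
    then have "b [^] j = \<one>" using rel car by simp
    then show ?thesis using i int_pow_eq_id car by blast
  qed
  then show ?thesis using g dvd by blast
qed

text \<open>The isomorphism sends (i, j) to a^i b^j for an independent generating pair; independence
  is its injectivity. The divisibility is recorded because it makes q the exponent of the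
  group.\<close>

lemma iso_integer_mod_group_pair:
  assumes fin: "finite (carrier G)" and gen: "pair_generates G (carrier G) a0 b0"
  shows "\<exists>p q \<phi>. 0 < p \<and> 0 < q \<and> p dvd q \<and>
           \<phi> \<in> iso (integer_mod_group p \<times>\<times> integer_mod_group q) G"
proof -
  obtain a b where g: "pair_generates G (carrier G) a b" and dvd: "ord a dvd ord b"
    and ind: "\<And>(i::int) (j::int). a [^] i \<otimes> b [^] j = \<one> \<Longrightarrow> int (ord a) dvd i \<and> int (ord b) dvd j"
    using independent_generating_pair[OF assms] by blast
  have car: "a \<in> carrier G" "b \<in> carrier G" using g by (auto simp: pair_generates_def)
  have pos: "ord a > 0" "ord b > 0" using ord_ge_1[OF fin] car by force+
  have modp: "a [^] (i mod int (ord a)) = a [^] i" "b [^] (i mod int (ord b)) = b [^] i" for i :: int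
    using car by (simp_all add: int_pow_eq dvd_minus_mod)
  let ?Z = "integer_mod_group (ord a) \<times>\<times> integer_mod_group (ord b)"
  define \<phi> where "\<phi> = (\<lambda>(i::int, j::int). a [^] i \<otimes> b [^] j)"
  have "\<phi> \<in> hom ?Z G"
    by (rule homI) (use car in \<open>auto simp: \<phi>_def modp int_pow_mult m_ac\<close>)
  moreover have "bij_betw \<phi> (carrier ?Z) (carrier G)"
  proof (rule bij_betw_imageI)
    show "inj_on \<phi> (carrier ?Z)"
    proof (rule inj_onI, clarify)
      fix i j k l assume c: "(i, j) \<in> carrier ?Z" "(k, l) \<in> carrier ?Z" and "\<phi> (i, j) = \<phi> (k, l)"
      then have "a [^] i \<otimes> b [^] j = a [^] k \<otimes> b [^] l" by (simp add: \<phi>_def)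
      moreover have "a [^] (i - k) \<otimes> b [^] (j - l) = (a [^] i \<otimes> b [^] j) \<otimes> inv (a [^] k \<otimes> b [^] l)"
        using car by (simp add: int_pow_diff inv_mult m_ac)
      ultimately have "a [^] (i - k) \<otimes> b [^] (j - l) = \<one>" using car by simp
      then have "i mod int (ord a) = k mod int (ord a)" "j mod int (ord b) = l mod int (ord b)"
        using ind[of "i - k" "j - l"] by (simp_all add: mod_eq_dvd_iff)
      moreover have "0 \<le> i" "i < int (ord a)" "0 \<le> k" "k < int (ord a)"
        "0 \<le> j" "j < int (ord b)" "0 \<le> l" "l < int (ord b)"
        using c pos by (auto simp: carrier_integer_mod_group)
      ultimately show "i = k \<and> j = l"
        by simp
    qed
    show "\<phi> ` carrier ?Z = carrier G"
    proof
      show "\<phi> ` carrier ?Z \<subseteq> carrier G" using car by (auto simp: \<phi>_def)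
      show "carrier G \<subseteq> \<phi> ` carrier ?Z"
      proof
        fix x assume "x \<in> carrier G"
        then obtain i j :: int where "x = a [^] i \<otimes> b [^] j" using g by (auto simp: pair_generates_def)
        then have "x = \<phi> (i mod int (ord a), j mod int (ord b))" by (simp add: \<phi>_def modp)
        moreover have "(i mod int (ord a), j mod int (ord b)) \<in> carrier ?Z"
          using pos by (simp add: carrier_integer_mod_group)
        ultimately show "x \<in> \<phi> ` carrier ?Z" by blast
      qed
    qed
  qed
  ultimately have "\<phi> \<in> iso ?Z G" by (simp add: iso_def)
  then show ?thesis using pos dvd by blast
qed

end

lemma (in group) iso_integer_mod_group_cyclic:
  assumes fin: "finite (carrier G)" and a: "a \<in> carrier G"
    and gen: "\<And>x. x \<in> carrier G \<Longrightarrow> \<exists>i::int. x = a [^] i"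
  shows "\<exists>c \<phi>. 0 < c \<and> \<phi> \<in> iso (integer_mod_group c) G"
proof -
  have pos: "ord a > 0" using ord_ge_1[OF fin a] by simp
  have modp: "a [^] (i mod int (ord a)) = a [^] i" for i :: int
    using a by (simp add: int_pow_eq dvd_minus_mod)
  let ?Z = "integer_mod_group (ord a)"
  define \<phi> where "\<phi> = (\<lambda>i::int. a [^] i)"
  have "\<phi> \<in> hom ?Z G"
    by (rule homI) (use a in \<open>auto simp: \<phi>_def modp int_pow_mult\<close>)
  moreover have "bij_betw \<phi> (carrier ?Z) (carrier G)"
  proof (rule bij_betw_imageI)
    show "inj_on \<phi> (carrier ?Z)"
    proof (rule inj_onI)
      fix i k assume c: "i \<in> carrier ?Z" "k \<in> carrier ?Z" and "\<phi> i = \<phi> k"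
      then have "int (ord a) dvd k - i" using a by (simp add: \<phi>_def int_pow_eq)
      then have "k mod int (ord a) = i mod int (ord a)" by (simp add: mod_eq_dvd_iff)
      then show "i = k" using c pos by (simp add: carrier_integer_mod_group)
    qed
    show "\<phi> ` carrier ?Z = carrier G"
    proof
      show "\<phi> ` carrier ?Z \<subseteq> carrier G" using a by (auto simp: \<phi>_def)
      show "carrier G \<subseteq> \<phi> ` carrier ?Z"
      proof
        fix x assume "x \<in> carrier G"
        then obtain i :: int where "x = a [^] i" using gen by blast
        then have "x = \<phi> (i mod int (ord a))" by (simp add: \<phi>_def modp)
        moreover have "i mod int (ord a) \<in> carrier ?Z"
          using pos by (simp add: carrier_integer_mod_group)
        ultimately show "x \<in> \<phi> ` carrier ?Z" by blast
      qed
    qed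
  qed
  ultimately show ?thesis using pos by (auto simp: iso_def)
qed

section \<open>Quotients of subgroups as epimorphisms onto concrete groups\<close>

lemma subgroup_restrict_normal:
  assumes "comm_group G" "subgroup A G" "subgroup N G" "N \<subseteq> A"
  shows "comm_group (G\<lparr>carrier := A\<rparr>)" "N \<lhd> G\<lparr>carrier := A\<rparr>"
proof -
  interpret comm_group G by fact
  show c: "comm_group (G\<lparr>carrier := A\<rparr>)"
    using subgroup.mem_carrier[OF assms(2)] subgroup_imp_group[OF assms(2)]
    by (intro group.group_comm_groupI) (auto simp: m_comm)
  have "subgroup N (G\<lparr>carrier := A\<rparr>)" using assms by (simp add: subgroup_incl)
  then show "N \<lhd> G\<lparr>carrier := A\<rparr>"
    using c comm_group.axioms(2) comm_group.normal_iff_subgroup by blast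
qed

text \<open>The epimorphism is the projection to cosets followed by the inverse of
  \<open>\<phi>\<close>; the cardinality is Lagrange's theorem inside A.\<close>

lemma quotient_map_of_iso:
  assumes "comm_group G" "subgroup A G" "subgroup N G" "N \<subseteq> A" "finite A" "group W"
    and "\<phi> \<in> iso W (G\<lparr>carrier := A\<rparr> Mod N)"
  shows "\<exists>\<alpha>. quotient_map G A N W \<alpha>" and "card A = card (carrier W) * card N"
proof -
  let ?A = "G\<lparr>carrier := A\<rparr>"
  interpret G: comm_group G by fact
  interpret A: comm_group ?A using subgroup_restrict_normal[OF assms(1-4)] by simp
  interpret N: normal N ?A using subgroup_restrict_normal[OF assms(1-4)] by simp
  interpret W: group W by fact
  define \<psi> where "\<psi> = inv_into (carrier W) \<phi>"
  have \<psi>: "\<psi> \<in> iso (?A Mod N) W"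
    unfolding \<psi>_def by (rule W.iso_set_sym[OF assms(7)])
  interpret h: group_hom "?A Mod N" W \<psi>
    using \<psi> N.factorgroup_is_group by (simp add: group_hom_def group_hom_axioms_def iso_def W.group_axioms)
  have inj: "inj_on \<psi> (carrier (?A Mod N))" and sur: "\<psi> ` carrier (?A Mod N) = carrier W"
    using \<psi> by (auto simp: iso_def bij_betw_def)
  define \<alpha> where "\<alpha> = (\<lambda>x. \<psi> (N #>\<^bsub>?A\<^esub> x))"
  have car: "N #>\<^bsub>?A\<^esub> x \<in> carrier (?A Mod N)" if "x \<in> A" for x
    using that by (simp add: carrier_FactGroup)
  have "quotient_map G A N W \<alpha>"
    unfolding quotient_map_def
  proof (intro conjI ballI)
    fix x y assume xy: "x \<in> A" "y \<in> A"
    have "N #>\<^bsub>?A\<^esub> (x \<otimes>\<^bsub>G\<^esub> y) = (N #>\<^bsub>?A\<^esub> x) \<otimes>\<^bsub>?A Mod N\<^esub> (N #>\<^bsub>?A\<^esub> y)"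
      using N.rcos_sum[of x y] xy by simp
    then show "\<alpha> (x \<otimes>\<^bsub>G\<^esub> y) = \<alpha> x \<otimes>\<^bsub>W\<^esub> \<alpha> y"
      using h.hom_mult[OF car[OF xy(1)] car[OF xy(2)]] by (simp add: \<alpha>_def)
  next
    have "\<alpha> ` A = \<psi> ` ((\<lambda>x. N #>\<^bsub>?A\<^esub> x) ` A)" by (simp add: \<alpha>_def image_image)
    then show "\<alpha> ` A = carrier W" using sur by (simp add: carrier_FactGroup)
  next
    have "\<alpha> x = \<one>\<^bsub>W\<^esub> \<longleftrightarrow> x \<in> N" if x: "x \<in> A" for x
    proof -
      have "\<alpha> x = \<one>\<^bsub>W\<^esub> \<longleftrightarrow> \<psi> (N #>\<^bsub>?A\<^esub> x) = \<psi> \<one>\<^bsub>?A Mod N\<^esub>" using h.hom_one by (simp add: \<alpha>_def)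
      also have "\<dots> \<longleftrightarrow> N #>\<^bsub>?A\<^esub> x = N"
        using inj_on_eq_iff[OF inj car[OF x] h.G.one_closed] by simp
      also have "\<dots> \<longleftrightarrow> x \<in> N"
        using A.coset_join1[of N x] A.coset_join2[of x N] x N.subgroup_axioms N.subset by auto
      finally show ?thesis .
    qed
    then show "{x \<in> A. \<alpha> x = \<one>\<^bsub>W\<^esub>} = N" using assms(4) by auto
  qed
  then show "\<exists>\<alpha>. quotient_map G A N W \<alpha>" by blast
  have "card (rcosets\<^bsub>?A\<^esub> N) * card N = card A"
    using A.lagrange[OF N.subgroup_axioms] by (simp add: order_def)
  moreover have "card (rcosets\<^bsub>?A\<^esub> N) = card (carrier W)"
    using bij_betw_same_card[of \<psi> "carrier (?A Mod N)" "carrier W"] inj sur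
    by (simp add: bij_betw_def FactGroup_def)
  ultimately show "card A = card (carrier W) * card N" by simp
qed

lemma FactGroup_restrict_int_pow:
  assumes "comm_group G" "subgroup A G" "subgroup N G" "N \<subseteq> A" "a \<in> A"
  shows "(N #>\<^bsub>G\<lparr>carrier := A\<rparr>\<^esub> a) [^]\<^bsub>G\<lparr>carrier := A\<rparr> Mod N\<^esub> (i::int) =
         N #>\<^bsub>G\<lparr>carrier := A\<rparr>\<^esub> (a [^]\<^bsub>G\<^esub> i)"
proof -
  interpret G: comm_group G by fact
  interpret N: normal N "G\<lparr>carrier := A\<rparr>" using subgroup_restrict_normal[OF assms(1-4)] by simp
  show ?thesis
    using N.FactGroup_int_pow[of a i] G.int_pow_consistent[OF assms(2,5), of i] assms(5) by simp
qed

text \<open>The cosets of a and b generate A/N, so the structure of finite abelian groups with two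
  generators applies to it. With N trivial the result describes A itself.\<close>

lemma quotient_map_pair_exists:
  assumes "comm_group G" "subgroup A G" "subgroup N G" "N \<subseteq> A" "finite A" "pair_generates G A a b"
  shows "\<exists>u v \<alpha>. 0 < u \<and> 0 < v \<and> u dvd v \<and> card A = u * v * card N \<and>
           quotient_map G A N (integer_mod_group u \<times>\<times> integer_mod_group v) \<alpha>"
proof -
  let ?A = "G\<lparr>carrier := A\<rparr>"
  interpret A: comm_group ?A using subgroup_restrict_normal[OF assms(1-4)] by simp
  interpret N: normal N ?A using subgroup_restrict_normal[OF assms(1-4)] by simp
  interpret Q: comm_group "?A Mod N" using A.abelian_FactGroup[OF N.subgroup_axioms] .
  have "pair_generates (?A Mod N) (carrier (?A Mod N)) (N #>\<^bsub>?A\<^esub> a) (N #>\<^bsub>?A\<^esub> b)"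
    unfolding pair_generates_def
  proof (intro conjI ballI)
    have ab: "a \<in> A" "b \<in> A" using assms(6) by (auto simp: pair_generates_def)
    then show "N #>\<^bsub>?A\<^esub> a \<in> carrier (?A Mod N)" "N #>\<^bsub>?A\<^esub> b \<in> carrier (?A Mod N)"
      by (simp_all add: carrier_FactGroup)
    fix Y assume "Y \<in> carrier (?A Mod N)"
    then obtain x where x: "x \<in> A" "Y = N #>\<^bsub>?A\<^esub> x" by (auto simp: carrier_FactGroup)
    then obtain i j :: int where ij: "x = a [^]\<^bsub>G\<^esub> i \<otimes>\<^bsub>G\<^esub> b [^]\<^bsub>G\<^esub> j"
      using assms(6) by (auto simp: pair_generates_def)
    have "a [^]\<^bsub>G\<^esub> i \<in> A" "b [^]\<^bsub>G\<^esub> j \<in> A"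
      using ab group.subgroup_int_pow_closed[OF comm_group.axioms(2)[OF assms(1)] assms(2)] by blast+
    then have "Y = (N #>\<^bsub>?A\<^esub> (a [^]\<^bsub>G\<^esub> i)) \<otimes>\<^bsub>?A Mod N\<^esub> (N #>\<^bsub>?A\<^esub> (b [^]\<^bsub>G\<^esub> j))"
      using N.rcos_sum[of "a [^]\<^bsub>G\<^esub> i" "b [^]\<^bsub>G\<^esub> j"] x ij by simp
    then show "\<exists>(i::int) (j::int). Y = (N #>\<^bsub>?A\<^esub> a) [^]\<^bsub>?A Mod N\<^esub> i \<otimes>\<^bsub>?A Mod N\<^esub> (N #>\<^bsub>?A\<^esub> b) [^]\<^bsub>?A Mod N\<^esub> j"
      unfolding FactGroup_restrict_int_pow[OF assms(1-4) ab(1)]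
        FactGroup_restrict_int_pow[OF assms(1-4) ab(2)] by blast
  qed
  moreover have "finite (carrier (?A Mod N))" using assms(5) by (simp add: carrier_FactGroup)
  ultimately obtain u v \<phi> where uv: "0 < u" "0 < v" "u dvd v"
    and \<phi>: "\<phi> \<in> iso (integer_mod_group u \<times>\<times> integer_mod_group v) (?A Mod N)"
    using Q.iso_integer_mod_group_pair by blast
  have W: "group (integer_mod_group u \<times>\<times> integer_mod_group v)" by (simp add: DirProd_group)
  have "card (carrier (integer_mod_group u \<times>\<times> integer_mod_group v)) = u * v"
    using uv by (simp add: carrier_integer_mod_group card_cartesian_product)
  then have "card A = u * v * card N" using quotient_map_of_iso(2)[OF assms(1-5) W \<phi>] by simp
  then show ?thesis using uv quotient_map_of_iso(1)[OF assms(1-5) W \<phi>] by blast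
qed

lemma quotient_map_cyclic_exists:
  assumes "comm_group G" "subgroup A G" "subgroup N G" "N \<subseteq> A" "finite A"
    and "a \<in> A" and gen: "\<And>x. x \<in> A \<Longrightarrow> \<exists>i::int. x = a [^]\<^bsub>G\<^esub> i"
  shows "\<exists>c \<alpha>. 0 < c \<and> card A = c * card N \<and> quotient_map G A N (integer_mod_group c) \<alpha>"
proof -
  let ?A = "G\<lparr>carrier := A\<rparr>"
  interpret N: normal N ?A using subgroup_restrict_normal[OF assms(1-4)] by simp
  interpret Q: group "?A Mod N" using N.factorgroup_is_group .
  have "\<exists>i::int. Y = (N #>\<^bsub>?A\<^esub> a) [^]\<^bsub>?A Mod N\<^esub> i" if Y: "Y \<in> carrier (?A Mod N)" for Y
  proof -
    obtain x where x: "x \<in> A" "Y = N #>\<^bsub>?A\<^esub> x" using Y by (auto simp: carrier_FactGroup)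
    then obtain i :: int where "x = a [^]\<^bsub>G\<^esub> i" using gen by blast
    then show ?thesis unfolding x(2) FactGroup_restrict_int_pow[OF assms(1-4,6)] by blast
  qed
  moreover have "finite (carrier (?A Mod N))" using assms(5) by (simp add: carrier_FactGroup)
  moreover have "N #>\<^bsub>?A\<^esub> a \<in> carrier (?A Mod N)" using assms(6) by (simp add: carrier_FactGroup)
  ultimately obtain c \<phi> where c: "0 < c" and \<phi>: "\<phi> \<in> iso (integer_mod_group c) (?A Mod N)"
    using Q.iso_integer_mod_group_cyclic[of "N #>\<^bsub>?A\<^esub> a"] by blast
  have "card (carrier (integer_mod_group c)) = c"
    using c by (simp add: carrier_integer_mod_group)
  then have "card A = c * card N"
    using quotient_map_of_iso(2)[OF assms(1-5) group_integer_mod_group \<phi>] by simp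
  then show ?thesis
    using c quotient_map_of_iso(1)[OF assms(1-5) group_integer_mod_group \<phi>] by blast
qed

subsection \<open>Cyclic groups\<close>

text \<open>An endomorphism is multiplication by its value at 1, and it is bijective exactly when
  that value is a unit modulo c.\<close>

lemma card_auto_integer_mod_group:
  assumes c: "0 < c"
  shows "card (auto (integer_mod_group c)) = totient c"
proof -
  let ?Z = "integer_mod_group c"
  have car: "carrier ?Z = {0..<int c}" using c by (simp add: carrier_integer_mod_group)
  define f where "f = (\<lambda>k::nat. \<lambda>x\<in>{0..<int c}. (int k * x) mod int c)"
  have "bij_betw f (totatives c) (auto ?Z)"
  proof (rule bij_betw_imageI)
    \<comment> \<open>For c > 1 the value at 1 recovers the multiplier. For c = 1 the number 1 is
      not a residue, but then there is only one totative.\<close>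
    show "inj_on f (totatives c)"
    proof (cases "c = 1")
      case False
      show ?thesis
      proof (rule inj_onI)
        fix k l assume kl: "k \<in> totatives c" "l \<in> totatives c" "f k = f l"
        have "k < c" "l < c" using kl False c totatives_less by force+
        moreover have "f k 1 = f l 1" using kl by simp
        ultimately show "k = l" using False c by (simp add: f_def)
      qed
    qed simp
    show "f ` totatives c = auto ?Z"
    proof (intro equalityI subsetI)
      fix \<theta> assume "\<theta> \<in> f ` totatives c"
      then obtain k where k: "k \<in> totatives c" and \<theta>: "\<theta> = f k" by blast
      have cop: "coprime (int c) (int k)" using k by (simp add: totatives_def coprime_commute)
      have "f k \<in> hom ?Z ?Z"
      proof (rule homI)
        fix x y assume xy: "x \<in> carrier ?Z" "y \<in> carrier ?Z"
        show "f k x \<in> carrier ?Z" using xy c by (simp add: f_def car)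
        have "(x + y) mod int c \<in> {0..<int c}" using c by simp
        then show "f k (x \<otimes>\<^bsub>?Z\<^esub> y) = f k x \<otimes>\<^bsub>?Z\<^esub> f k y"
          using xy by (simp add: f_def car mod_simps distrib_left)
      qed
      moreover have "inj_on (f k) {0..<int c}"
      proof (rule inj_onI)
        fix x y assume xy: "x \<in> {0..<int c}" "y \<in> {0..<int c}" "f k x = f k y"
        then have "int c dvd int k * (x - y)"
          by (simp add: f_def mod_eq_dvd_iff right_diff_distrib)
        then have "int c dvd x - y" using cop by (simp add: coprime_dvd_mult_right_iff)
        then have "x mod int c = y mod int c" by (simp add: mod_eq_dvd_iff)
        then show "x = y" using xy by simp
      qed
      moreover have "f k ` {0..<int c} \<subseteq> {0..<int c}" using c by (auto simp: f_def)
      moreover have "f k \<in> extensional {0..<int c}" by (simp add: f_def)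
      ultimately show "\<theta> \<in> auto ?Z"
        unfolding \<theta> auto_def Bij_def car
        using endo_inj_surj[of "{0..<int c}" "f k"] by (simp add: bij_betw_def)
    next
      fix \<theta> assume \<theta>: "\<theta> \<in> auto ?Z"
      note t = autoD[OF group_integer_mod_group \<theta>]
      show "\<theta> \<in> f ` totatives c"
      proof (cases "c = 1")
        case True
        have "carrier ?Z = {0}" unfolding car using True by auto
        moreover have "f 1 \<in> extensional (carrier ?Z)" by (simp add: f_def car)
        moreover have "f 1 0 = 0" using c by (simp add: f_def)
        ultimately have "\<theta> = f 1"
          using t(3) by (intro extensionalityI[OF t(7)]) auto
        then show ?thesis using True by simp
      next
        case False
        interpret h: group_hom ?Z ?Z \<theta>
          using \<theta> by (simp add: group_hom_def group_hom_axioms_def auto_def)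
        have one: "1 \<in> carrier ?Z" using False by simp
        define k where "k = nat (\<theta> 1)"
        have k: "\<theta> 1 = int k" "k < c" using t(1)[OF one] by (auto simp: car k_def)
        have val: "\<theta> x = (int k * x) mod int c" if x: "x \<in> carrier ?Z" for x
        proof -
          have "\<theta> (1 [^]\<^bsub>?Z\<^esub> nat x) = \<theta> 1 [^]\<^bsub>?Z\<^esub> nat x" using h.hom_nat_pow[OF one] .
          then show ?thesis using x k by (simp add: car mult.commute)
        qed
        \<comment> \<open>A preimage of 1 is an inverse of k modulo c.\<close>
        obtain y where y: "y \<in> carrier ?Z" "\<theta> y = 1" using t(6) one by (metis imageE)
        then have "(int k * y) mod int c = 1" using val by simp
        then have "coprime (int k) (int c)"
          using coprime_mod_left_iff[of "int c" "int k * y"] c by simp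
        then have cop: "coprime k c" by simp
        then have "k > 0" using False by (cases k) auto
        then have "k \<in> totatives c" using cop k by (simp add: totatives_def)
        moreover have "\<theta> = f k"
        proof (rule extensionalityI[OF t(7)])
          show "f k \<in> extensional (carrier ?Z)" by (simp add: f_def car)
          show "\<theta> x = f k x" if "x \<in> carrier ?Z" for x using val[OF that] that by (simp add: f_def car)
        qed
        ultimately show ?thesis by blast
      qed
    qed
  qed
  then show ?thesis by (simp add: totient_def bij_betw_same_card)
qed

text \<open>For d dividing m this is the subgroup of order d. It is indexed by its order and not by
  its generator because the Goursat parameters are products of orders.\<close>

definition cyclic_subgroup :: "nat \<Rightarrow> nat \<Rightarrow> int set" where
  "cyclic_subgroup m d = {x \<in> {0..<int m}. int (m div d) dvd x}"

lemma card_cyclic_subgroup: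
  assumes "0 < m" "d dvd m"
  shows "card (cyclic_subgroup m d) = d"
proof -
  obtain e where m: "m = d * e" using assms(2) by blast
  then have de: "0 < d" "0 < e" using assms(1) by auto
  have "bij_betw (\<lambda>i::nat. int (e * i)) {..<d} (cyclic_subgroup m d)"
  proof (rule bij_betw_imageI)
    show "inj_on (\<lambda>i::nat. int (e * i)) {..<d}" using de by (auto simp: inj_on_def)
    show "(\<lambda>i::nat. int (e * i)) ` {..<d} = cyclic_subgroup m d"
    proof (intro equalityI subsetI)
      fix x assume "x \<in> (\<lambda>i::nat. int (e * i)) ` {..<d}"
      then obtain i where i: "i < d" "x = int (e * i)" by blast
      then have "e * i < d * e" using de by (simp add: mult.commute)
      then show "x \<in> cyclic_subgroup m d" using i de by (simp add: cyclic_subgroup_def m flip: of_nat_mult)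
    next
      fix x assume x: "x \<in> cyclic_subgroup m d"
      then obtain y where y: "x = int y" by (auto simp: cyclic_subgroup_def elim: nonneg_int_cases)
      then have "e dvd y" "y < d * e" using x de by (auto simp: cyclic_subgroup_def m simp flip: of_nat_mult)
      then obtain i where "y = e * i" by blast
      moreover from this have "i < d" using \<open>y < d * e\<close> de by (simp add: mult.commute)
      ultimately show "x \<in> (\<lambda>i::nat. int (e * i)) ` {..<d}" using y by blast
    qed
  qed
  then show ?thesis using bij_betw_same_card by fastforce
qed

lemma subgroup_cyclic_subgroup:
  assumes "0 < m" "d dvd m"
  shows "subgroup (cyclic_subgroup m d) (integer_mod_group m)"
proof (rule group.subgroupI[OF group_integer_mod_group])
  have dm: "int (m div d) dvd int m" using assms by (metis dvd_div_mult_self dvd_triv_left int_dvd_int_iff)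
  have mem: "x mod int m \<in> cyclic_subgroup m d" if "int (m div d) dvd x" for x
    using that dm assms(1) by (simp add: cyclic_subgroup_def dvd_mod)
  show sub: "cyclic_subgroup m d \<subseteq> carrier (integer_mod_group m)"
    using assms by (auto simp: cyclic_subgroup_def carrier_integer_mod_group)
  show "cyclic_subgroup m d \<noteq> {}" using mem[of 0] by auto
  fix x assume x: "x \<in> cyclic_subgroup m d"
  then show "inv\<^bsub>integer_mod_group m\<^esub> x \<in> cyclic_subgroup m d"
    using sub mem[of "- x"] by (auto simp: cyclic_subgroup_def)
  fix y assume "y \<in> cyclic_subgroup m d"
  then show "x \<otimes>\<^bsub>integer_mod_group m\<^esub> y \<in> cyclic_subgroup m d"
    using mem[of "x + y"] x by (simp add: cyclic_subgroup_def)
qed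

lemma subgroup_pow_card:
  assumes "group G" "subgroup A G" "x \<in> A"
  shows "x [^]\<^bsub>G\<^esub> card A = \<one>\<^bsub>G\<^esub>"
proof -
  interpret G: group G by fact
  interpret A: group "G\<lparr>carrier := A\<rparr>" using G.subgroup_imp_group[OF assms(2)] .
  have "x [^]\<^bsub>G\<lparr>carrier := A\<rparr>\<^esub> order (G\<lparr>carrier := A\<rparr>) = \<one>\<^bsub>G\<lparr>carrier := A\<rparr>\<^esub>"
    using A.pow_order_eq_1 assms(3) by simp
  then show ?thesis by (simp add: order_def flip: G.nat_pow_consistent)
qed

text \<open>Write m = |A| e. Each x in A is annihilated by |A|, so m divides |A| x and e divides x.
  Hence A is contained in a set with as many elements as A.\<close>

lemma subgroup_integer_mod_group:
  assumes m: "0 < m" and A: "subgroup A (integer_mod_group m)"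
  shows "card A dvd m" "A = cyclic_subgroup m (card A)"
proof -
  have car: "carrier (integer_mod_group m) = {0..<int m}" using m by (simp add: carrier_integer_mod_group)
  show d: "card A dvd m"
    using group.lagrange[OF group_integer_mod_group A] by (simp add: order_def car) (metis dvd_triv_right)
  obtain e where e: "m = card A * e" using d by blast
  then have pos: "0 < card A" "0 < e" using m by auto
  have "A \<subseteq> cyclic_subgroup m (card A)"
  proof
    fix x assume x: "x \<in> A"
    have "(int (card A) * x) mod int m = 0"
      using subgroup_pow_card[OF group_integer_mod_group A x] by simp
    then have "int m dvd int (card A) * x" by (simp add: mod_eq_0_iff_dvd)
    moreover have "int m = int (card A) * int e" using e by (metis of_nat_mult)
    ultimately have "int (card A) * int e dvd int (card A) * x" by simp
    then have "int e dvd x" using pos by simp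
    moreover have "m div card A = e" using pos(1) by (subst e) simp
    ultimately show "x \<in> cyclic_subgroup m (card A)"
      using subgroup.subset[OF A] x by (auto simp: cyclic_subgroup_def car)
  qed
  moreover have "finite (cyclic_subgroup m (card A))"
    by (rule finite_subset[of _ "{0..<int m}"]) (auto simp: cyclic_subgroup_def)
  ultimately show "A = cyclic_subgroup m (card A)"
    using card_cyclic_subgroup[OF m d] by (simp add: card_subset_eq)
qed

lemma cyclic_subgroup_mono:
  assumes "0 < m" "d' dvd m" "d dvd d'"
  shows "cyclic_subgroup m d \<subseteq> cyclic_subgroup m d'"
proof -
  obtain e f where "m = d' * e" "d' = d * f" using assms by blast
  then have "m div d' dvd m div d" using assms(1) by (simp add: mult.assoc)
  then show ?thesis unfolding cyclic_subgroup_def by (auto intro: dvd_trans simp flip: int_dvd_int_iff)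
qed

lemma card_dvd_card_subgroup:
  assumes "group G" "subgroup A G" "subgroup N G" "N \<subseteq> A"
  shows "card N dvd card A"
proof -
  interpret G: group G by fact
  interpret A: group "G\<lparr>carrier := A\<rparr>" using G.subgroup_imp_group[OF assms(2)] .
  show ?thesis
    using A.lagrange[OF G.subgroup_incl[OF assms(3,2,4)]] by (simp add: order_def) (metis dvd_triv_right)
qed

lemma cyclic_subgroup_generator:
  assumes "0 < m" "d dvd m"
  shows "\<exists>g\<in>cyclic_subgroup m d. \<forall>x\<in>cyclic_subgroup m d. \<exists>i::int. x = g [^]\<^bsub>integer_mod_group m\<^esub> i"
proof
  interpret subgroup "cyclic_subgroup m d" "integer_mod_group m" using subgroup_cyclic_subgroup[OF assms] .
  have dm: "int (m div d) dvd int m" using assms by (metis dvd_div_mult_self dvd_triv_left int_dvd_int_iff)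
  \<comment> \<open>The reduction matters only for d = 1, where the generator m has to be
    represented by 0.\<close>
  show "int (m div d) mod int m \<in> cyclic_subgroup m d"
    using dm assms(1) by (simp add: cyclic_subgroup_def dvd_mod)
  show "\<forall>x\<in>cyclic_subgroup m d. \<exists>i::int. x = (int (m div d) mod int m) [^]\<^bsub>integer_mod_group m\<^esub> i"
  proof
    fix x assume x: "x \<in> cyclic_subgroup m d"
    then obtain i where i: "x = int (m div d) * i" by (auto simp: cyclic_subgroup_def)
    have "x = (i * (int (m div d) mod int m)) mod int m"
      using x i by (simp add: cyclic_subgroup_def mod_mult_right_eq mult.commute)
    then show "\<exists>i::int. x = (int (m div d) mod int m) [^]\<^bsub>integer_mod_group m\<^esub> i"
      unfolding int_pow_integer_mod_group by blast
  qed
qed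

section \<open>Exponents of subgroups and quotients of cyclic groups\<close>

lemma relative_exponent_cyclic_subgroup:
  assumes "0 < m" "d dvd m"
  shows "relative_exponent (integer_mod_group m) (cyclic_subgroup m d) {0} d"
  unfolding relative_exponent_def
proof (intro allI)
  fix t :: nat
  obtain e where m: "m = d * e" using assms(2) by blast
  then have de: "0 < d" "0 < e" using assms(1) by auto
  have "(\<forall>x\<in>cyclic_subgroup m d. (int t * x) mod int m = 0) \<longleftrightarrow> d dvd t"
  proof
    assume all: "\<forall>x\<in>cyclic_subgroup m d. (int t * x) mod int m = 0"
    show "d dvd t"
    \<comment> \<open>The exponent is tested on the generator e, which for d = 1 equals m and is no
      residue.\<close>
    proof (cases "d = 1")
      case False
      then have "int e \<in> cyclic_subgroup m d" using de by (simp add: cyclic_subgroup_def m)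
      then have "(int t * int e) mod int m = 0" using all by blast
      then have "int d * int e dvd int t * int e" by (simp add: m mod_eq_0_iff_dvd)
      then show ?thesis using de by simp
    qed simp
  next
    assume "d dvd t"
    then show "\<forall>x\<in>cyclic_subgroup m d. (int t * x) mod int m = 0"
      using de by (auto simp: cyclic_subgroup_def m mod_eq_0_iff_dvd intro!: mult_dvd_mono)
  qed
  then show "(\<forall>x\<in>cyclic_subgroup m d. x [^]\<^bsub>integer_mod_group m\<^esub> t \<in> {0}) \<longleftrightarrow> d dvd t" by simp
qed

lemma relative_exponent_integer_mod_group:
  assumes "0 < m" "d dvd m"
  shows "relative_exponent (integer_mod_group m) (carrier (integer_mod_group m)) (cyclic_subgroup m d) (m div d)"
  unfolding relative_exponent_def
proof (intro allI)
  fix t :: nat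
  have dm: "m div d dvd m" using assms by (metis dvd_div_mult_self dvd_triv_left)
  have car: "carrier (integer_mod_group m) = {0..<int m}" using assms(1) by (simp add: carrier_integer_mod_group)
  have "(\<forall>x\<in>{0..<int m}. (int t * x) mod int m \<in> cyclic_subgroup m d) \<longleftrightarrow> m div d dvd t"
  proof
    assume all: "\<forall>x\<in>{0..<int m}. (int t * x) mod int m \<in> cyclic_subgroup m d"
    show "m div d dvd t"
    \<comment> \<open>The element 1 alone decides the claim, but it is a residue only for m >
      1.\<close>
    proof (cases "m = 1")
      case True
      then show ?thesis using assms(2) by simp
    next
      case False
      then have "1 \<in> {0..<int m}" using assms(1) by simp
      then have "(int t * 1) mod int m \<in> cyclic_subgroup m d" by (rule bspec[OF all])
      then have "int (m div d) dvd int t mod int m" by (simp add: cyclic_subgroup_def)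
      then have "m div d dvd t mod m" by (simp flip: zmod_int)
      then show ?thesis using dvd_mod_iff[OF dm] by blast
    qed
  next
    assume "m div d dvd t"
    then have "int (m div d) dvd int t * x" for x by simp
    moreover have "int (m div d) dvd int m" using dm by simp
    ultimately show "\<forall>x\<in>{0..<int m}. (int t * x) mod int m \<in> cyclic_subgroup m d"
      using assms(1) by (simp add: cyclic_subgroup_def dvd_mod)
  qed
  then show "(\<forall>x\<in>carrier (integer_mod_group m). x [^]\<^bsub>integer_mod_group m\<^esub> t \<in> cyclic_subgroup m d) \<longleftrightarrow> m div d dvd t"
    unfolding car pow_integer_mod_group .
qed

section \<open>Powers and exponents in direct products\<close>

lemma pow_DirProd:
  "(a, b) [^]\<^bsub>G \<times>\<times> H\<^esub> (t::nat) = (a [^]\<^bsub>G\<^esub> t, b [^]\<^bsub>H\<^esub> t)"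
proof (induction t)
  case 0
  show ?case unfolding nat_pow_def by simp
next
  case (Suc t)
  have "(a, b) [^]\<^bsub>G \<times>\<times> H\<^esub> Suc t = (a, b) [^]\<^bsub>G \<times>\<times> H\<^esub> t \<otimes>\<^bsub>G \<times>\<times> H\<^esub> (a, b)"
    by (simp add: nat_pow_def)
  also have "\<dots> = (a [^]\<^bsub>G\<^esub> t \<otimes>\<^bsub>G\<^esub> a, b [^]\<^bsub>H\<^esub> t \<otimes>\<^bsub>H\<^esub> b)" using Suc by simp
  also have "\<dots> = (a [^]\<^bsub>G\<^esub> Suc t, b [^]\<^bsub>H\<^esub> Suc t)" by (simp add: nat_pow_def)
  finally show ?case .
qed

lemma int_pow_DirProd:
  assumes "group G" "group H" "a \<in> carrier G" "b \<in> carrier H"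
  shows "(a, b) [^]\<^bsub>G \<times>\<times> H\<^esub> (i::int) = (a [^]\<^bsub>G\<^esub> i, b [^]\<^bsub>H\<^esub> i)"
proof -
  interpret G: group G by fact
  interpret H: group H by fact
  show ?thesis using assms(3,4) unfolding int_pow_def2[of "G \<times>\<times> H"] int_pow_def2[of G] int_pow_def2[of H]
    by (simp add: pow_DirProd G.group_axioms H.group_axioms)
qed

text \<open>Powers are taken componentwise, so t annihilates \<open>K\<close> exactly when it
  annihilates both projections.\<close>

lemma relative_exponent_DirProd_subgroup:
  assumes "relative_exponent G (Domain K) {\<one>\<^bsub>G\<^esub>} d" "relative_exponent H (Range K) {\<one>\<^bsub>H\<^esub>} e"
  shows "relative_exponent (G \<times>\<times> H) K {\<one>\<^bsub>G \<times>\<times> H\<^esub>} (lcm d e)"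
  unfolding relative_exponent_def
proof (intro allI)
  fix t :: nat
  have "(\<forall>p\<in>K. p [^]\<^bsub>G \<times>\<times> H\<^esub> t \<in> {\<one>\<^bsub>G \<times>\<times> H\<^esub>}) \<longleftrightarrow>
        (\<forall>a\<in>Domain K. a [^]\<^bsub>G\<^esub> t \<in> {\<one>\<^bsub>G\<^esub>}) \<and> (\<forall>b\<in>Range K. b [^]\<^bsub>H\<^esub> t \<in> {\<one>\<^bsub>H\<^esub>})"
    by (auto simp: pow_DirProd) blast+
  then show "(\<forall>p\<in>K. p [^]\<^bsub>G \<times>\<times> H\<^esub> t \<in> {\<one>\<^bsub>G \<times>\<times> H\<^esub>}) \<longleftrightarrow> lcm d e dvd t"
    using assms by (simp add: relative_exponent_def)
qed

text \<open>For the quotient the slices take over the role of the projections: all t-th powers lie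
  in \<open>K\<close> as soon as those of (a, 1) and (1, b) do, since these multiply to the power of
  (a, b).\<close>

lemma relative_exponent_DirProd_quotient:
  assumes "group G" "group H" "subgroup K (G \<times>\<times> H)"
    and "relative_exponent G (carrier G) (K\<inverse> `` {\<one>\<^bsub>H\<^esub>}) d"
    and "relative_exponent H (carrier H) (K `` {\<one>\<^bsub>G\<^esub>}) e"
  shows "relative_exponent (G \<times>\<times> H) (carrier (G \<times>\<times> H)) K (lcm d e)"
  unfolding relative_exponent_def
proof (intro allI)
  interpret G: group G by fact
  interpret H: group H by fact
  fix t :: nat
  have "(\<forall>p\<in>carrier (G \<times>\<times> H). p [^]\<^bsub>G \<times>\<times> H\<^esub> t \<in> K) \<longleftrightarrow>
        (\<forall>a\<in>carrier G. a [^]\<^bsub>G\<^esub> t \<in> K\<inverse> `` {\<one>\<^bsub>H\<^esub>}) \<and> (\<forall>b\<in>carrier H. b [^]\<^bsub>H\<^esub> t \<in> K `` {\<one>\<^bsub>G\<^esub>})"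
    (is "?l \<longleftrightarrow> ?r")
  proof
    assume l: ?l
    have "(a [^]\<^bsub>G\<^esub> t, \<one>\<^bsub>H\<^esub>) \<in> K" if "a \<in> carrier G" for a
      using bspec[OF l, of "(a, \<one>\<^bsub>H\<^esub>)"] that by (simp add: pow_DirProd)
    moreover have "(\<one>\<^bsub>G\<^esub>, b [^]\<^bsub>H\<^esub> t) \<in> K" if "b \<in> carrier H" for b
      using bspec[OF l, of "(\<one>\<^bsub>G\<^esub>, b)"] that by (simp add: pow_DirProd)
    ultimately show ?r by blast
  next
    assume r: ?r
    have "(a [^]\<^bsub>G\<^esub> t, b [^]\<^bsub>H\<^esub> t) \<in> K" if "a \<in> carrier G" "b \<in> carrier H" for a b
    proof -
      have "(a [^]\<^bsub>G\<^esub> t, \<one>\<^bsub>H\<^esub>) \<in> K" "(\<one>\<^bsub>G\<^esub>, b [^]\<^bsub>H\<^esub> t) \<in> K" using r that by blast+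
      then have "(a [^]\<^bsub>G\<^esub> t \<otimes>\<^bsub>G\<^esub> \<one>\<^bsub>G\<^esub>, \<one>\<^bsub>H\<^esub> \<otimes>\<^bsub>H\<^esub> b [^]\<^bsub>H\<^esub> t) \<in> K"
        by (rule subgroup_DirProdD(3)[OF assms(1-3)])
      then show ?thesis using that by simp
    qed
    then show ?l by (auto simp: pow_DirProd)
  qed
  then show "(\<forall>p\<in>carrier (G \<times>\<times> H). p [^]\<^bsub>G \<times>\<times> H\<^esub> t \<in> K) \<longleftrightarrow> lcm d e dvd t"
    using assms(4,5) by (simp add: relative_exponent_def)
qed

lemma subgroup_nat_pow_closed:
  assumes "group G" "subgroup A G" "x \<in> A"
  shows "x [^]\<^bsub>G\<^esub> (t::nat) \<in> A"
  by (induction t) (use assms subgroup.one_closed subgroup.m_closed in \<open>auto simp: nat_pow_def\<close>)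

lemma relative_exponent_quotient_map:
  assumes "group G" "group W" "subgroup A G" "quotient_map G A N W \<alpha>"
    and "relative_exponent W (carrier W) {\<one>\<^bsub>W\<^esub>} e"
  shows "relative_exponent G A N e"
  unfolding relative_exponent_def
proof (intro allI)
  fix t :: nat
  note a = quotient_mapD[OF assms(1-4)]
  have "(\<forall>x\<in>A. x [^]\<^bsub>G\<^esub> t \<in> N) \<longleftrightarrow> (\<forall>x\<in>A. \<alpha> x [^]\<^bsub>W\<^esub> t = \<one>\<^bsub>W\<^esub>)"
    using a(4,7) subgroup_nat_pow_closed[OF assms(1,3)] by simp
  also have "\<dots> \<longleftrightarrow> (\<forall>w\<in>\<alpha> ` A. w [^]\<^bsub>W\<^esub> t = \<one>\<^bsub>W\<^esub>)" by blast
  also have "\<dots> \<longleftrightarrow> e dvd t" using assms(5) a(2) by (simp add: relative_exponent_def)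
  finally show "(\<forall>x\<in>A. x [^]\<^bsub>G\<^esub> t \<in> N) \<longleftrightarrow> e dvd t" .
qed

text \<open>A function is needed so that the exponent can be an argument of a summand. The value is
  unspecified if no exponent exists; \<open>pair_quotient\<close> shows that one exists in the
  groups considered.\<close>

definition rel_exp :: "('a, 'm) monoid_scheme \<Rightarrow> 'a set \<Rightarrow> 'a set \<Rightarrow> nat" where
  "rel_exp G A N = (THE e. relative_exponent G A N e)"

lemma rel_exp_eq: "relative_exponent G A N e \<Longrightarrow> rel_exp G A N = e"
  unfolding rel_exp_def by (rule the_equality) (auto intro: relative_exponent_unique)

text \<open>With trivial kernel \<open>\<alpha>\<close> is an isomorphism from A to W. Taking images
  matches the subgroups and preserves order and relative exponent, which is all that h sees.\<close>

lemma sum_subgroups_isomorphic: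
  assumes "group G" "group W" "subgroup A G" "quotient_map G A {\<one>\<^bsub>G\<^esub>} W \<alpha>"
  shows "(\<Sum>N\<in>{N. subgroup N G \<and> N \<subseteq> A}. h (card N) (rel_exp G A N)) =
         (\<Sum>M\<in>{M. subgroup M W}. h (card M) (rel_exp W (carrier W) M))"
proof -
  interpret G: group G by fact
  interpret W: group W by fact
  note a = quotient_mapD[OF assms]
  have Asub: "A \<subseteq> carrier G" by (rule subgroup.subset[OF assms(3)])
  have inj: "inj_on \<alpha> A"
  proof (rule inj_onI)
    fix x y assume xy: "x \<in> A" "y \<in> A" "\<alpha> x = \<alpha> y"
    then have "inv\<^bsub>G\<^esub> x \<otimes>\<^bsub>G\<^esub> y = \<one>\<^bsub>G\<^esub>" using a(9) by simp
    then show "x = y" using xy Asub G.inv_solve_left'[of "\<one>\<^bsub>G\<^esub>" x y] by (auto simp: subset_iff)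
  qed
  have img: "subgroup (\<alpha> ` N) W" if N: "subgroup N G" "N \<subseteq> A" for N
  proof (rule W.subgroupI)
    show "\<alpha> ` N \<subseteq> carrier W" using a(3) N by auto
    show "\<alpha> ` N \<noteq> {}" using subgroup.one_closed[OF N(1)] by blast
  next
    fix w assume "w \<in> \<alpha> ` N"
    then obtain x where x: "x \<in> N" "w = \<alpha> x" by blast
    then have "inv\<^bsub>W\<^esub> w = \<alpha> (inv\<^bsub>G\<^esub> x)" using a(6) N by auto
    then show "inv\<^bsub>W\<^esub> w \<in> \<alpha> ` N" using subgroup.m_inv_closed[OF N(1) x(1)] by blast
  next
    fix w v assume "w \<in> \<alpha> ` N" "v \<in> \<alpha> ` N"
    then obtain x y where x: "x \<in> N" "w = \<alpha> x" "y \<in> N" "v = \<alpha> y" by blast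
    then have "w \<otimes>\<^bsub>W\<^esub> v = \<alpha> (x \<otimes>\<^bsub>G\<^esub> y)" using a(1)[of x y] N(2) x by (simp add: subsetD)
    then show "w \<otimes>\<^bsub>W\<^esub> v \<in> \<alpha> ` N" using subgroup.m_closed[OF N(1) x(1,3)] by blast
  qed
  have bij: "bij_betw ((`) \<alpha>) {N. subgroup N G \<and> N \<subseteq> A} {M. subgroup M W}"
  proof (rule bij_betw_imageI)
    show "inj_on ((`) \<alpha>) {N. subgroup N G \<and> N \<subseteq> A}"
      by (rule inj_on_subset[OF inj_on_image_Pow[OF inj]]) auto
    show "(`) \<alpha> ` {N. subgroup N G \<and> N \<subseteq> A} = {M. subgroup M W}"
    proof (intro equalityI subsetI)
      fix M assume "M \<in> {M. subgroup M W}"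
      then have M: "subgroup M W" by simp
      let ?N = "{x \<in> A. \<alpha> x \<in> M}"
      have "subgroup ?N G"
      proof (rule G.subgroupI)
        show "?N \<noteq> {}" using a(5) subgroup.one_closed[OF M] subgroup.one_closed[OF assms(3)] by auto
        show "inv\<^bsub>G\<^esub> x \<in> ?N" if "x \<in> ?N" for x
          using that a(6) subgroup.m_inv_closed[OF M] subgroup.m_inv_closed[OF assms(3)] by simp
        show "x \<otimes>\<^bsub>G\<^esub> y \<in> ?N" if "x \<in> ?N" "y \<in> ?N" for x y
          using that a(1) subgroup.m_closed[OF M] subgroup.m_closed[OF assms(3)] by simp
      qed (use Asub in auto)
      moreover have "M \<subseteq> \<alpha> ` A" using subgroup.subset[OF M] a(2) by simp
      then have "\<alpha> ` ?N = M" by blast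
      ultimately show "M \<in> (`) \<alpha> ` {N. subgroup N G \<and> N \<subseteq> A}" by blast
    qed (use img in auto)
  qed
  have eq: "h (card N) (rel_exp G A N) = h (card (\<alpha> ` N)) (rel_exp W (carrier W) (\<alpha> ` N))"
    if N: "N \<in> {N. subgroup N G \<and> N \<subseteq> A}" for N
  proof -
    have "card (\<alpha> ` N) = card N" using N inj by (auto intro: card_image inj_on_subset)
    \<comment> \<open>Equivalence for every e makes the two definite descriptions equal, without any
      existence argument.\<close>
    moreover have "relative_exponent G A N e \<longleftrightarrow> relative_exponent W (carrier W) (\<alpha> ` N) e" for e
    proof -
      have "x [^]\<^bsub>G\<^esub> t \<in> N \<longleftrightarrow> \<alpha> x [^]\<^bsub>W\<^esub> t \<in> \<alpha> ` N" if x: "x \<in> A" for x and t :: nat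
        using inj_on_image_mem_iff[OF inj subgroup_nat_pow_closed[OF assms(1,3) x]] N a(7)[OF x] by auto
      then have "(\<forall>x\<in>A. x [^]\<^bsub>G\<^esub> t \<in> N) \<longleftrightarrow> (\<forall>w\<in>\<alpha> ` A. w [^]\<^bsub>W\<^esub> t \<in> \<alpha> ` N)" for t :: nat by auto
      then show ?thesis using a(2) by (simp add: relative_exponent_def)
    qed
    ultimately show ?thesis by (simp add: rel_exp_def)
  qed
  show ?thesis
    unfolding sum.reindex_bij_betw[OF bij, symmetric] by (rule sum.cong[OF refl eq])
qed

text \<open>An extension of a cyclic group by a cyclic group has two generators: a lift (g, b) of
  the generator of the projection, and (1, h) for the generator of the slice.\<close>

lemma pair_generates_DirProd_subgroup:
  assumes "comm_group G" "comm_group H" "subgroup K (G \<times>\<times> H)"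
    and "g \<in> Domain K" "\<And>x. x \<in> Domain K \<Longrightarrow> \<exists>i::int. x = g [^]\<^bsub>G\<^esub> i"
    and "h \<in> K `` {\<one>\<^bsub>G\<^esub>}" "\<And>y. y \<in> K `` {\<one>\<^bsub>G\<^esub>} \<Longrightarrow> \<exists>j::int. y = h [^]\<^bsub>H\<^esub> j"
  shows "\<exists>a b. pair_generates (G \<times>\<times> H) K a b"
proof -
  interpret G: comm_group G by fact
  interpret H: comm_group H by fact
  note gr = G.group_axioms H.group_axioms
  note D = subgroup_DirProdD[OF gr assms(3)]
  obtain b where b: "(g, b) \<in> K" using assms(4) by blast
  have h: "(\<one>\<^bsub>G\<^esub>, h) \<in> K" using assms(6) by blast
  have car: "g \<in> carrier G" "b \<in> carrier H" "h \<in> carrier H" using D(2) b h by auto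
  have "\<exists>(i::int) (j::int). p = (g, b) [^]\<^bsub>G \<times>\<times> H\<^esub> i \<otimes>\<^bsub>G \<times>\<times> H\<^esub> (\<one>\<^bsub>G\<^esub>, h) [^]\<^bsub>G \<times>\<times> H\<^esub> j"
    if p: "p \<in> K" for p
  proof -
    obtain x y where xy: "p = (x, y)" by (cases p)
    then have xyK: "(x, y) \<in> K" using p by simp
    then obtain i :: int where i: "x = g [^]\<^bsub>G\<^esub> i" using assms(5) by blast
    have "(g, b) [^]\<^bsub>G \<times>\<times> H\<^esub> i \<in> K"
      using group.subgroup_int_pow_closed[OF DirProd_group[OF gr] assms(3) b] .
    then have bi: "(x, b [^]\<^bsub>H\<^esub> i) \<in> K" using int_pow_DirProd[OF gr car(1,2)] i by simp
    have yc: "y \<in> carrier H" using D(2) xyK by blast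
    \<comment> \<open>Removing the i-th power of (g, b) from (x, y) leaves an element of the
      slice.\<close>
    have "inv\<^bsub>H\<^esub> (b [^]\<^bsub>H\<^esub> i) \<otimes>\<^bsub>H\<^esub> y \<in> K `` {\<one>\<^bsub>G\<^esub>}"
      using subgroup_DirProd_fibre[OF gr assms(3) bi yc] xyK by simp
    then obtain j :: int where "inv\<^bsub>H\<^esub> (b [^]\<^bsub>H\<^esub> i) \<otimes>\<^bsub>H\<^esub> y = h [^]\<^bsub>H\<^esub> j" using assms(7) by blast
    then have "y = b [^]\<^bsub>H\<^esub> i \<otimes>\<^bsub>H\<^esub> h [^]\<^bsub>H\<^esub> j"
      using H.inv_solve_left'[of "h [^]\<^bsub>H\<^esub> j" "b [^]\<^bsub>H\<^esub> i" y] car yc by simp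
    then have "p = (g, b) [^]\<^bsub>G \<times>\<times> H\<^esub> i \<otimes>\<^bsub>G \<times>\<times> H\<^esub> (\<one>\<^bsub>G\<^esub>, h) [^]\<^bsub>G \<times>\<times> H\<^esub> j"
      using int_pow_DirProd[OF gr car(1,2)] int_pow_DirProd[OF gr G.one_closed car(3)] xy i car by simp
    then show ?thesis by blast
  qed
  then show ?thesis using b h unfolding pair_generates_def by blast
qed

subsection \<open>Subgroups of a product of two cyclic groups\<close>

text \<open>The Goursat parameters of a subgroup of \<open>\<int>\<^sub>m \<times> \<int>\<^sub>n\<close>: in \<open>\<int>\<^sub>m\<close>
  the slice has order \<open>x1\<close> and the projection index \<open>x2\<close>, in \<open>\<int>\<^sub>n\<close> the slice has order \<open>x4\<close>
  and the projection index \<open>x5\<close>, and the common quotient has order \<open>x3\<close>.\<close>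

definition factor_tuples :: "nat \<Rightarrow> nat \<Rightarrow> (nat \<times> nat \<times> nat \<times> nat \<times> nat) set" where
  "factor_tuples m n = {(x1, x2, x3, x4, x5).
     0 \<notin> {x1, x2, x3, x4, x5} \<and> x1 * x2 * x3 = m \<and> x3 * x4 * x5 = n}"

lemma factor_tuplesD:
  assumes "(x1, x2, x3, x4, x5) \<in> factor_tuples m n"
  shows "0 < x1" "0 < x2" "0 < x3" "0 < x4" "0 < x5"
    and "x1 * x2 * x3 = m" "x3 * x4 * x5 = n"
    and "0 < m" "0 < n"
    and "x1 * x3 dvd m" "x1 dvd m" "x3 * x4 dvd n" "x4 dvd n"
    and "m div x1 = x2 * x3" "n div x4 = x3 * x5"
proof -
  show a: "0 < x1" "0 < x2" "0 < x3" "0 < x4" "0 < x5" "x1 * x2 * x3 = m" "x3 * x4 * x5 = n"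
    using assms by (auto simp: factor_tuples_def)
  then show "0 < m" "0 < n" by auto
  have m: "m = (x1 * x3) * x2" "m = x1 * (x2 * x3)" and n: "n = (x3 * x4) * x5" "n = x4 * (x3 * x5)"
    using a by (auto simp: mult_ac)
  show "x1 * x3 dvd m" using m(1) by simp
  show "x1 dvd m" using m(2) by simp
  show "x3 * x4 dvd n" using n(1) by simp
  show "x4 dvd n" using n(2) by simp
  show "m div x1 = x2 * x3" using m(2) a(1) by simp
  show "n div x4 = x3 * x5" using n(2) a(4) by simp
qed

lemma finite_factor_tuples:
  assumes "0 < m" "0 < n"
  shows "finite (factor_tuples m n)"
proof (rule finite_subset)
  have le: "a \<le> m" if "a dvd m" for a using dvd_imp_le[OF that assms(1)] .
  have le': "a \<le> n" if "a dvd n" for a using dvd_imp_le[OF that assms(2)] .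
  show "factor_tuples m n \<subseteq> {..m} \<times> {..m} \<times> {..m} \<times> {..n} \<times> {..n}"
    unfolding factor_tuples_def by (auto intro!: le le')
  show "finite ({..m} \<times> {..m} \<times> {..m} \<times> {..n} \<times> {..n})" by simp
qed

definition pair_class :: "nat \<Rightarrow> nat \<Rightarrow> nat \<times> nat \<times> nat \<times> nat \<times> nat \<Rightarrow> (int \<times> int) set set" where
  "pair_class m n = (\<lambda>(x1, x2, x3, x4, x5).
     Goursat_class (integer_mod_group m) (integer_mod_group n)
       (cyclic_subgroup m (x1 * x3)) (cyclic_subgroup m x1)
       (cyclic_subgroup n (x3 * x4)) (cyclic_subgroup n x4))"

lemma pair_classD:
  assumes "K \<in> pair_class m n (x1, x2, x3, x4, x5)"
  shows "subgroup K (integer_mod_group m \<times>\<times> integer_mod_group n)"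
    and "Domain K = cyclic_subgroup m (x1 * x3)" "K\<inverse> `` {0} = cyclic_subgroup m x1"
    and "Range K = cyclic_subgroup n (x3 * x4)" "K `` {0} = cyclic_subgroup n x4"
  using assms by (auto simp: pair_class_def Goursat_class_def)

lemma finite_carrier_integer_mod_group: "0 < m \<Longrightarrow> finite (carrier (integer_mod_group m))"
  by (simp add: carrier_integer_mod_group)

text \<open>A subgroup of a cyclic group is known from its order, so four orders d, d', e, e'
  describe projections and slices. Counting \<open>K\<close> over either factor gives d e' = e d',
  hence the two quotients have the same order, and this is x3.\<close>

lemma pair_class_exists:
  assumes m: "0 < m" and n: "0 < n" and K: "subgroup K (integer_mod_group m \<times>\<times> integer_mod_group n)"
  shows "\<exists>x\<in>factor_tuples m n. K \<in> pair_class m n x"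
proof -
  note gr = group_integer_mod_group[of m] group_integer_mod_group[of n]
  note fin = finite_carrier_integer_mod_group[OF m] finite_carrier_integer_mod_group[OF n]
  define d d' e e' where "d = card (Domain K)" and "d' = card (K\<inverse> `` {0})"
    and "e = card (Range K)" and "e' = card (K `` {0})"
  have subs: "subgroup (Domain K) (integer_mod_group m)" "subgroup (K\<inverse> `` {0}) (integer_mod_group m)"
    "subgroup (Range K) (integer_mod_group n)" "subgroup (K `` {0}) (integer_mod_group n)"
    using subgroup_Domain[OF gr K] subgroup_Image_converse_one[OF gr K]
      subgroup_Range[OF gr K] subgroup_Image_one[OF gr K] by simp_all
  have eqs: "Domain K = cyclic_subgroup m d" "K\<inverse> `` {0} = cyclic_subgroup m d'"
    "Range K = cyclic_subgroup n e" "K `` {0} = cyclic_subgroup n e'"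
    unfolding d_def d'_def e_def e'_def
    using subgroup_integer_mod_group(2)[OF m] subgroup_integer_mod_group(2)[OF n] subs by blast+
  have dvds: "d dvd m" "e dvd n"
    unfolding d_def e_def
    using subgroup_integer_mod_group(1)[OF m] subgroup_integer_mod_group(1)[OF n] subs by blast+
  have "d' dvd d"
    unfolding d_def d'_def by (rule card_dvd_card_subgroup[OF gr(1) subs(1,2)]) auto
  then obtain c where c: "d = d' * c" by blast
  have "e' dvd e"
    unfolding e_def e'_def by (rule card_dvd_card_subgroup[OF gr(2) subs(3,4)]) auto
  then obtain c' where c': "e = e' * c'" by blast
  obtain f g where fg: "m = d * f" "n = e * g" using dvds by blast
  then have pos: "0 < d'" "0 < c" "0 < f" "0 < e'" "0 < c'" "0 < g" using m n c c' by auto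
  have "d * e' = e * d'"
    using card_subgroup_DirProd[OF gr K fin] card_subgroup_DirProd'[OF gr K fin]
    by (simp add: d_def d'_def e_def e'_def)
  then have "c = c'" using c c' pos by (simp add: mult_ac)
  then have "(d', f, c, e', g) \<in> factor_tuples m n"
    using pos fg c c' by (auto simp: factor_tuples_def mult_ac)
  moreover have "K \<in> pair_class m n (d', f, c, e', g)"
    using K eqs c c' \<open>c = c'\<close> by (simp add: pair_class_def Goursat_class_def mult.commute)
  ultimately show ?thesis by blast
qed

lemma pair_class_disjoint:
  assumes "x \<in> factor_tuples m n" "y \<in> factor_tuples m n" "K \<in> pair_class m n x" "K \<in> pair_class m n y"
  shows "x = y"
proof -
  obtain x1 x2 x3 x4 x5 where x: "x = (x1, x2, x3, x4, x5)" by (cases x)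
  obtain y1 y2 y3 y4 y5 where y: "y = (y1, y2, y3, y4, y5)" by (cases y)
  note X = factor_tuplesD[OF assms(1)[unfolded x]]
  note Y = factor_tuplesD[OF assms(2)[unfolded y]]
  note kx = pair_classD[OF assms(3)[unfolded x]]
  note ky = pair_classD[OF assms(4)[unfolded y]]
  have "x1 = y1"
    using kx(3) ky(3) card_cyclic_subgroup[OF X(8) X(11)] card_cyclic_subgroup[OF Y(8) Y(11)] by simp
  moreover have "x4 = y4"
    using kx(5) ky(5) card_cyclic_subgroup[OF X(9) X(13)] card_cyclic_subgroup[OF Y(9) Y(13)] by simp
  moreover have "x1 * x3 = y1 * y3"
    using kx(2) ky(2) card_cyclic_subgroup[OF X(8) X(10)] card_cyclic_subgroup[OF Y(8) Y(10)] by simp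
  ultimately have e: "x1 = y1" "x4 = y4" "x3 = y3" using X(1) by auto
  have "y1 * (x2 * y3) = y1 * (y2 * y3)" "y3 * y4 * x5 = y3 * y4 * y5"
    using X(6,7) Y(6,7) e by (simp_all add: mult.assoc)
  then have "x2 = y2" "x5 = y5" using Y(1-5) by auto
  then show ?thesis using e x y by simp
qed

lemma card_pair_class:
  assumes "(x1, x2, x3, x4, x5) \<in> factor_tuples m n"
  shows "card (pair_class m n (x1, x2, x3, x4, x5)) = totient x3"
proof -
  note X = factor_tuplesD[OF assms]
  \<comment> \<open>The quotient is cyclic of some order, and comparing cardinalities shows that
    this order is c. It is needed once for each factor.\<close>
  have cyc: "\<exists>\<alpha>. quotient_map (integer_mod_group l) (cyclic_subgroup l (d * c)) (cyclic_subgroup l d)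
      (integer_mod_group c) \<alpha>"
    if l: "0 < l" and dc: "d * c dvd l" for l d c
  proof -
    have d: "d dvd l" using dc by (rule dvd_mult_left)
    obtain g where g: "g \<in> cyclic_subgroup l (d * c)"
      and gen: "\<And>x. x \<in> cyclic_subgroup l (d * c) \<Longrightarrow> \<exists>i::int. x = g [^]\<^bsub>integer_mod_group l\<^esub> i"
      using cyclic_subgroup_generator[OF l dc] by blast
    have fin: "finite (cyclic_subgroup l (d * c))"
      by (rule finite_subset[of _ "{0..<int l}"]) (auto simp: cyclic_subgroup_def)
    obtain c' \<alpha> where c': "card (cyclic_subgroup l (d * c)) = c' * card (cyclic_subgroup l d)"
      and \<alpha>: "quotient_map (integer_mod_group l) (cyclic_subgroup l (d * c)) (cyclic_subgroup l d)
        (integer_mod_group c') \<alpha>"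
      using quotient_map_cyclic_exists[OF abelian_integer_mod_group subgroup_cyclic_subgroup[OF l dc]
          subgroup_cyclic_subgroup[OF l d] cyclic_subgroup_mono[OF l dc] fin g gen] by auto
    have "0 < d" using l d by (auto intro: Nat.gr0I)
    then have "c' = c" using c' card_cyclic_subgroup[OF l dc] card_cyclic_subgroup[OF l d] by simp
    then show ?thesis using \<alpha> by blast
  qed
  obtain \<alpha> where \<alpha>: "quotient_map (integer_mod_group m) (cyclic_subgroup m (x1 * x3)) (cyclic_subgroup m x1)
      (integer_mod_group x3) \<alpha>"
    using cyc[OF X(8,10)] by blast
  have "x4 * x3 dvd n" using X(12) by (simp add: mult.commute)
  from cyc[OF X(9) this] obtain \<beta> where \<beta>: "quotient_map (integer_mod_group n)
      (cyclic_subgroup n (x3 * x4)) (cyclic_subgroup n x4) (integer_mod_group x3) \<beta>"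
    by (auto simp: mult.commute)
  have "card (pair_class m n (x1, x2, x3, x4, x5)) = card (auto (integer_mod_group x3))"
    unfolding pair_class_def prod.case
    by (rule card_Goursat_class[OF group_integer_mod_group group_integer_mod_group group_integer_mod_group
          subgroup_cyclic_subgroup[OF X(8,10)] subgroup_cyclic_subgroup[OF X(9,12)] \<alpha> \<beta>])
  then show ?thesis using card_auto_integer_mod_group[OF X(3)] by simp
qed

text \<open>The projections have orders x1 x3 and x3 x4, whose lcm is the exponent of
  \<open>K\<close>. Modulo the slices the factors have orders x2 x3 and x3 x5, whose lcm is the
  exponent of the quotient by \<open>K\<close>. The generators come from a cyclic projection and a
  cyclic slice.\<close>

lemma pair_class_invariants:
  assumes x: "(x1, x2, x3, x4, x5) \<in> factor_tuples m n"
    and K: "K \<in> pair_class m n (x1, x2, x3, x4, x5)"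
  defines "G \<equiv> integer_mod_group m \<times>\<times> integer_mod_group n"
  shows "card K = x1 * x3 * x4"
    and "relative_exponent G K {\<one>\<^bsub>G\<^esub>} (x3 * lcm x1 x4)"
    and "relative_exponent G (carrier G) K (x3 * lcm x2 x5)"
    and "\<exists>a b. pair_generates G K a b"
proof -
  note X = factor_tuplesD[OF x]
  note k = pair_classD[OF K]
  note gr = group_integer_mod_group[of m] group_integer_mod_group[of n]
  note fin = finite_carrier_integer_mod_group[OF X(8)] finite_carrier_integer_mod_group[OF X(9)]
  show "card K = x1 * x3 * x4"
    using card_subgroup_DirProd[OF gr k(1) fin] k(2,5)
      card_cyclic_subgroup[OF X(8,10)] card_cyclic_subgroup[OF X(9,13)] by simp
  have "relative_exponent G K {\<one>\<^bsub>G\<^esub>} (lcm (x1 * x3) (x3 * x4))"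
    unfolding G_def
    by (rule relative_exponent_DirProd_subgroup)
       (use k(2,4) relative_exponent_cyclic_subgroup[OF X(8,10)]
          relative_exponent_cyclic_subgroup[OF X(9,12)] in simp_all)
  moreover have "lcm (x1 * x3) (x3 * x4) = x3 * lcm x1 x4"
    using lcm_mult_left[of x3 x1 x4] by (simp add: mult.commute)
  ultimately show "relative_exponent G K {\<one>\<^bsub>G\<^esub>} (x3 * lcm x1 x4)" by simp
  have "relative_exponent G (carrier G) K (lcm (m div x1) (n div x4))"
    unfolding G_def
    by (rule relative_exponent_DirProd_quotient[OF gr k(1)])
       (use k(3,5) relative_exponent_integer_mod_group[OF X(8,11)]
          relative_exponent_integer_mod_group[OF X(9,13)] in simp_all)
  moreover have "lcm (m div x1) (n div x4) = x3 * lcm x2 x5"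
    using lcm_mult_left[of x3 x2 x5] X(14,15) by (simp add: mult.commute)
  ultimately show "relative_exponent G (carrier G) K (x3 * lcm x2 x5)" by simp
  obtain g where g: "g \<in> cyclic_subgroup m (x1 * x3)"
    "\<And>x. x \<in> cyclic_subgroup m (x1 * x3) \<Longrightarrow> \<exists>i::int. x = g [^]\<^bsub>integer_mod_group m\<^esub> i"
    using cyclic_subgroup_generator[OF X(8,10)] by blast
  obtain h where h: "h \<in> cyclic_subgroup n x4"
    "\<And>x. x \<in> cyclic_subgroup n x4 \<Longrightarrow> \<exists>i::int. x = h [^]\<^bsub>integer_mod_group n\<^esub> i"
    using cyclic_subgroup_generator[OF X(9,13)] by blast
  show "\<exists>a b. pair_generates G K a b"
    unfolding G_def
    by (rule pair_generates_DirProd_subgroup[OF abelian_integer_mod_group abelian_integer_mod_group k(1), of g h])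
       (use g h k(2,5) in simp_all)
qed

section \<open>Sums over subgroups as sums over Goursat parameters\<close>

lemma finite_subgroups:
  assumes "finite (carrier G)"
  shows "finite {K. subgroup K G}"
proof (rule finite_subset)
  show "{K. subgroup K G} \<subseteq> Pow (carrier G)" by (blast dest: subgroup.mem_carrier)
qed (use assms in simp)

lemma sum_pair_classes:
  fixes h :: "(int \<times> int) set \<Rightarrow> nat"
  assumes "0 < m" "0 < n"
  shows "(\<Sum>K\<in>{K. subgroup K (integer_mod_group m \<times>\<times> integer_mod_group n)}. h K) =
         (\<Sum>x\<in>factor_tuples m n. \<Sum>K\<in>pair_class m n x. h K)"
proof -
  let ?G = "integer_mod_group m \<times>\<times> integer_mod_group n"
  have sub: "pair_class m n x \<subseteq> {K. subgroup K ?G}" for x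
    using pair_classD(1) by (cases x) blast
  have fin: "finite {K. subgroup K ?G}"
    using finite_carrier_integer_mod_group assms by (intro finite_subgroups) simp
  have un: "{K. subgroup K ?G} = (\<Union>x\<in>factor_tuples m n. pair_class m n x)"
    using pair_class_exists[OF assms] sub by blast
  show ?thesis
    unfolding un
  proof (rule sum.UNION_disjoint[OF finite_factor_tuples[OF assms]])
    show "\<forall>x\<in>factor_tuples m n. finite (pair_class m n x)" using finite_subset[OF sub fin] by blast
    show "\<forall>x\<in>factor_tuples m n. \<forall>y\<in>factor_tuples m n.
        x \<noteq> y \<longrightarrow> pair_class m n x \<inter> pair_class m n y = {}"
      using pair_class_disjoint by blast
  qed
qed

text \<open>Order and exponent are constant on each class of subgroups, so every class contributes
  its size times one value.\<close>

lemma sum_subgroups_pair: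
  fixes f :: "nat \<Rightarrow> nat \<Rightarrow> nat"
  assumes "0 < u" "0 < v"
  defines "W \<equiv> integer_mod_group u \<times>\<times> integer_mod_group v"
  shows "(\<Sum>M\<in>{M. subgroup M W}. f (card M) (rel_exp W (carrier W) M)) =
         (\<Sum>(y1, y2, y3, y4, y5)\<in>factor_tuples u v. totient y3 * f (y1 * y3 * y4) (y3 * lcm y2 y5))"
proof -
  have "(\<Sum>M\<in>{M. subgroup M W}. f (card M) (rel_exp W (carrier W) M)) =
        (\<Sum>y\<in>factor_tuples u v. \<Sum>M\<in>pair_class u v y. f (card M) (rel_exp W (carrier W) M))"
    unfolding W_def by (rule sum_pair_classes[OF assms(1,2)])
  also have "\<dots> = (\<Sum>(y1, y2, y3, y4, y5)\<in>factor_tuples u v. totient y3 * f (y1 * y3 * y4) (y3 * lcm y2 y5))"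
  proof (rule sum.cong[OF refl], clarify)
    fix y1 y2 y3 y4 y5 assume y: "(y1, y2, y3, y4, y5) \<in> factor_tuples u v"
    have "(\<Sum>M\<in>pair_class u v (y1, y2, y3, y4, y5). f (card M) (rel_exp W (carrier W) M)) =
          (\<Sum>M\<in>pair_class u v (y1, y2, y3, y4, y5). f (y1 * y3 * y4) (y3 * lcm y2 y5))"
      using pair_class_invariants(1)[OF y] rel_exp_eq[OF pair_class_invariants(3)[OF y]]
      by (intro sum.cong refl) (simp add: W_def)
    then show "(\<Sum>M\<in>pair_class u v (y1, y2, y3, y4, y5). f (card M) (rel_exp W (carrier W) M)) =
        totient y3 * f (y1 * y3 * y4) (y3 * lcm y2 y5)"
      using card_pair_class[OF y] by simp
  qed
  finally show ?thesis .
qed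

text \<open>The divisibility u | v turns lcm(u, v) into v. Without it the second factor would not be
  the exponent.\<close>

lemma integer_mod_group_pair_exponent:
  assumes "0 < u" "0 < v" "u dvd v"
  defines "W \<equiv> integer_mod_group u \<times>\<times> integer_mod_group v"
  shows "relative_exponent W (carrier W) {\<one>\<^bsub>W\<^esub>} v"
proof -
  have c: "carrier (integer_mod_group l) = cyclic_subgroup l l" if "0 < l" for l
    using that by (auto simp: cyclic_subgroup_def carrier_integer_mod_group)
  have "carrier (integer_mod_group u) \<noteq> {}" "carrier (integer_mod_group v) \<noteq> {}"
    using integer_mod_group_0 by blast+
  then have dr: "Domain (carrier W) = carrier (integer_mod_group u)" "Range (carrier W) = carrier (integer_mod_group v)"
    by (auto simp: W_def Domain_fst Range_snd)
  have "relative_exponent (integer_mod_group u) (carrier (integer_mod_group u)) {0} u"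
    "relative_exponent (integer_mod_group v) (carrier (integer_mod_group v)) {0} v"
    using relative_exponent_cyclic_subgroup[OF assms(1) dvd_refl]
      relative_exponent_cyclic_subgroup[OF assms(2) dvd_refl] c assms(1,2) by simp_all
  then have "relative_exponent W (carrier W) {\<one>\<^bsub>W\<^esub>} (lcm u v)"
    using relative_exponent_DirProd_subgroup[of "integer_mod_group u" "carrier W" u "integer_mod_group v" v]
    unfolding dr by (simp add: W_def)
  moreover have "lcm u v = v" using assms(3) by (simp add: lcm_proj2_if_dvd)
  ultimately show ?thesis by simp
qed

text \<open>A subgroup \<open>A\<close> with parameters \<open>x\<close> is isomorphic to
  \<open>\<int>\<^sub>u \<times> \<int>\<^sub>v\<close> with \<open>u dvd v\<close>; its exponent forces \<open>v = x3 * lcm x1 x4\<close> and then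
  its order forces \<open>u = gcd x1 x4\<close>.\<close>

lemma sum_subgroup_pairs:
  fixes f :: "nat \<Rightarrow> nat \<Rightarrow> nat \<Rightarrow> nat"
  assumes "0 < m" "0 < n"
  defines "G \<equiv> integer_mod_group m \<times>\<times> integer_mod_group n"
  shows "(\<Sum>A\<in>{A. subgroup A G}. \<Sum>N\<in>{N. subgroup N G \<and> N \<subseteq> A}. f (card A) (card N) (rel_exp G A N)) =
    (\<Sum>(x1, x2, x3, x4, x5)\<in>factor_tuples m n.
      \<Sum>(y1, y2, y3, y4, y5)\<in>factor_tuples (gcd x1 x4) (x3 * lcm x1 x4).
        totient x3 * (totient y3 * f (x1 * x3 * x4) (y1 * y3 * y4) (y3 * lcm y2 y5)))"
proof -
  have grp: "group G" by (simp add: G_def DirProd_group)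
  have com: "comm_group G"
    by (rule group.group_comm_groupI[OF grp]) (auto simp: G_def add.commute)
  have finG: "finite (carrier G)" using assms finite_carrier_integer_mod_group by (simp add: G_def)
  have "(\<Sum>A\<in>{A. subgroup A G}. \<Sum>N\<in>{N. subgroup N G \<and> N \<subseteq> A}. f (card A) (card N) (rel_exp G A N)) =
    (\<Sum>x\<in>factor_tuples m n. \<Sum>A\<in>pair_class m n x.
       \<Sum>N\<in>{N. subgroup N G \<and> N \<subseteq> A}. f (card A) (card N) (rel_exp G A N))"
    unfolding G_def by (rule sum_pair_classes[OF assms(1,2)])
  also have "\<dots> = (\<Sum>(x1, x2, x3, x4, x5)\<in>factor_tuples m n.
      \<Sum>(y1, y2, y3, y4, y5)\<in>factor_tuples (gcd x1 x4) (x3 * lcm x1 x4).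
        totient x3 * (totient y3 * f (x1 * x3 * x4) (y1 * y3 * y4) (y3 * lcm y2 y5)))"
  proof (rule sum.cong[OF refl], clarify)
    fix x1 x2 x3 x4 x5 assume x: "(x1, x2, x3, x4, x5) \<in> factor_tuples m n"
    note X = factor_tuplesD[OF x]
    let ?S = "\<Sum>(y1, y2, y3, y4, y5)\<in>factor_tuples (gcd x1 x4) (x3 * lcm x1 x4).
        totient y3 * f (x1 * x3 * x4) (y1 * y3 * y4) (y3 * lcm y2 y5)"
    have inner: "(\<Sum>N\<in>{N. subgroup N G \<and> N \<subseteq> A}. f (card A) (card N) (rel_exp G A N)) = ?S"
      if A: "A \<in> pair_class m n (x1, x2, x3, x4, x5)" for A
    proof -
      have sub: "subgroup A G" using pair_classD(1)[OF A] by (simp add: G_def)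
      note inv = pair_class_invariants[OF x A, folded G_def]
      obtain a b where ab: "pair_generates G A a b" using inv(4) by blast
      have one: "subgroup {\<one>\<^bsub>G\<^esub>} G" "{\<one>\<^bsub>G\<^esub>} \<subseteq> A"
        using group.triv_subgroup[OF grp] subgroup.one_closed[OF sub] by auto
      have finA: "finite A" using finite_subset[OF subgroup.subset[OF sub] finG] .
      obtain u v \<alpha> where uv: "0 < u" "0 < v" "u dvd v" "card A = u * v * card {\<one>\<^bsub>G\<^esub>}"
        and \<alpha>: "quotient_map G A {\<one>\<^bsub>G\<^esub>} (integer_mod_group u \<times>\<times> integer_mod_group v) \<alpha>"
        using quotient_map_pair_exists[OF com sub one finA ab] by blast
      let ?W = "integer_mod_group u \<times>\<times> integer_mod_group v"
      have W: "group ?W" by (simp add: DirProd_group)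
      have "relative_exponent G A {\<one>\<^bsub>G\<^esub>} v"
        using relative_exponent_quotient_map[OF grp W sub \<alpha> integer_mod_group_pair_exponent[OF uv(1-3)]] .
      then have v: "v = x3 * lcm x1 x4" using relative_exponent_unique inv(2) by blast
      have "u * v = gcd x1 x4 * v"
      proof -
        have "u * v = x3 * (x1 * x4)" using uv(4) inv(1) by (simp add: mult_ac)
        also have "\<dots> = x3 * (gcd x1 x4 * lcm x1 x4)" by (simp only: prod_gcd_lcm_nat[symmetric])
        also have "\<dots> = gcd x1 x4 * v" unfolding v by (simp add: mult_ac)
        finally show ?thesis .
      qed
      then have u: "u = gcd x1 x4" using uv(2) by simp
      \<comment> \<open>The subgroups of A are exchanged for those of the isomorphic product of two
        cyclic groups, to which the Goursat parameters apply again.\<close>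
      have "(\<Sum>N\<in>{N. subgroup N G \<and> N \<subseteq> A}. f (card A) (card N) (rel_exp G A N)) =
            (\<Sum>M\<in>{M. subgroup M ?W}. f (card A) (card M) (rel_exp ?W (carrier ?W) M))"
        by (rule sum_subgroups_isomorphic[OF grp W sub \<alpha>, of "f (card A)"])
      also have "\<dots> = (\<Sum>(y1, y2, y3, y4, y5)\<in>factor_tuples u v.
          totient y3 * f (card A) (y1 * y3 * y4) (y3 * lcm y2 y5))"
        by (rule sum_subgroups_pair[OF uv(1,2), of "f (card A)"])
      also have "\<dots> = ?S" unfolding u v inv(1) ..
      finally show ?thesis .
    qed
    have "(\<Sum>A\<in>pair_class m n (x1, x2, x3, x4, x5). \<Sum>N\<in>{N. subgroup N G \<and> N \<subseteq> A}.
        f (card A) (card N) (rel_exp G A N)) = (\<Sum>A\<in>pair_class m n (x1, x2, x3, x4, x5). ?S)"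
      by (rule sum.cong[OF refl inner])
    also have "\<dots> = totient x3 * ?S" by (simp add: card_pair_class[OF x])
    also have "\<dots> = (\<Sum>(y1, y2, y3, y4, y5)\<in>factor_tuples (gcd x1 x4) (x3 * lcm x1 x4).
        totient x3 * (totient y3 * f (x1 * x3 * x4) (y1 * y3 * y4) (y3 * lcm y2 y5)))"
      unfolding sum_distrib_left by (intro sum.cong refl) auto
    finally show "(\<Sum>A\<in>pair_class m n (x1, x2, x3, x4, x5). \<Sum>N\<in>{N. subgroup N G \<and> N \<subseteq> A}.
        f (card A) (card N) (rel_exp G A N)) = \<dots>" .
  qed
  finally show ?thesis .
qed

subsection \<open>Subgroups of a product of four cyclic groups\<close>

text \<open>The first tuple belongs to A. The second belongs to the image of N in a product of two
  cyclic groups isomorphic to A, and not to N as a subgroup of the original product.\<close>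

definition pair_tuples :: "nat \<Rightarrow> nat \<Rightarrow> ((nat \<times> nat \<times> nat \<times> nat \<times> nat) \<times> (nat \<times> nat \<times> nat \<times> nat \<times> nat)) set" where
  "pair_tuples m n = Sigma (factor_tuples m n)
     (\<lambda>(x1, x2, x3, x4, x5). factor_tuples (gcd x1 x4) (x3 * lcm x1 x4))"

lemma finite_pair_tuples:
  assumes "0 < m" "0 < n"
  shows "finite (pair_tuples m n)"
  unfolding pair_tuples_def
proof (rule finite_SigmaI[OF finite_factor_tuples[OF assms]], clarify)
  fix x1 x2 x3 x4 x5 assume "(x1, x2, x3, x4, x5) \<in> factor_tuples m n"
  note X = factor_tuplesD[OF this]
  show "finite (factor_tuples (gcd x1 x4) (x3 * lcm x1 x4))"
    using X(1,3,4) by (intro finite_factor_tuples) (auto simp: lcm_pos_nat)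
qed

text \<open>The function f stays arbitrary because the statement serves twice: for one half of the
  product with the numbers of the other half frozen, and then for that other half.\<close>

lemma sum_subgroup_pairs_pair_tuples:
  fixes f :: "nat \<Rightarrow> nat \<Rightarrow> nat \<Rightarrow> nat"
  assumes "0 < m" "0 < n"
  defines "G \<equiv> integer_mod_group m \<times>\<times> integer_mod_group n"
  shows "(\<Sum>(A, N)\<in>{(A, N). subgroup A G \<and> subgroup N G \<and> N \<subseteq> A}. f (card A) (card N) (rel_exp G A N)) =
    (\<Sum>((x1, x2, x3, x4, x5), (y1, y2, y3, y4, y5))\<in>pair_tuples m n.
        totient x3 * totient y3 * f (x1 * x3 * x4) (y1 * y3 * y4) (y3 * lcm y2 y5))"
proof -
  have fin: "finite {A. subgroup A G}"
    using assms finite_carrier_integer_mod_group by (intro finite_subgroups) (simp add: G_def)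
  have "{(A, N). subgroup A G \<and> subgroup N G \<and> N \<subseteq> A} =
        Sigma {A. subgroup A G} (\<lambda>A. {N. subgroup N G \<and> N \<subseteq> A})" by auto
  then have "(\<Sum>(A, N)\<in>{(A, N). subgroup A G \<and> subgroup N G \<and> N \<subseteq> A}. f (card A) (card N) (rel_exp G A N)) =
      (\<Sum>A\<in>{A. subgroup A G}. \<Sum>N\<in>{N. subgroup N G \<and> N \<subseteq> A}. f (card A) (card N) (rel_exp G A N))"
    using fin by (simp add: sum.Sigma)
  also have "\<dots> = (\<Sum>(x1, x2, x3, x4, x5)\<in>factor_tuples m n.
      \<Sum>(y1, y2, y3, y4, y5)\<in>factor_tuples (gcd x1 x4) (x3 * lcm x1 x4).
        totient x3 * (totient y3 * f (x1 * x3 * x4) (y1 * y3 * y4) (y3 * lcm y2 y5)))"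
    unfolding G_def by (rule sum_subgroup_pairs[OF assms(1,2)])
  also have "\<dots> = (\<Sum>x\<in>factor_tuples m n.
      \<Sum>y\<in>(case x of (x1, x2, x3, x4, x5) \<Rightarrow> factor_tuples (gcd x1 x4) (x3 * lcm x1 x4)).
        (case (x, y) of ((x1, x2, x3, x4, x5), (y1, y2, y3, y4, y5)) \<Rightarrow>
        totient x3 * totient y3 * f (x1 * x3 * x4) (y1 * y3 * y4) (y3 * lcm y2 y5)))"
    by (rule sum.cong[OF refl]) (auto simp: mult.assoc)
  also have "\<dots> = (\<Sum>((x1, x2, x3, x4, x5), (y1, y2, y3, y4, y5))\<in>pair_tuples m n.
        totient x3 * totient y3 * f (x1 * x3 * x4) (y1 * y3 * y4) (y3 * lcm y2 y5))"
    unfolding pair_tuples_def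
  proof (subst sum.Sigma)
    show "finite (factor_tuples m n)" by (rule finite_factor_tuples[OF assms(1,2)])
    show "\<forall>x\<in>factor_tuples m n. finite (case x of (x1, x2, x3, x4, x5) \<Rightarrow> factor_tuples (gcd x1 x4) (x3 * lcm x1 x4))"
    proof clarify
      fix x1 x2 x3 x4 x5 assume "(x1, x2, x3, x4, x5) \<in> factor_tuples m n"
      note X = factor_tuplesD[OF this]
      show "finite (factor_tuples (gcd x1 x4) (x3 * lcm x1 x4))"
        using X(1,3,4) by (intro finite_factor_tuples) (auto simp: lcm_pos_nat)
    qed
  qed (rule sum.cong, auto)
  finally show ?thesis .
qed

text \<open>Writing the second factor as the exponent fixes the target group: the cardinality
  equation then forces u = |A| / (|N| v). Quotients with equal numbers get literally the same
  target, as the count of a Goursat class requires.\<close>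

lemma pair_quotient:
  assumes "0 < m" "0 < n"
  defines "G \<equiv> integer_mod_group m \<times>\<times> integer_mod_group n"
  assumes "subgroup A G" "subgroup N G" "N \<subseteq> A"
  shows "\<exists>u \<alpha>. 0 < u \<and> 0 < rel_exp G A N \<and> card A = u * rel_exp G A N * card N \<and>
     relative_exponent G A N (rel_exp G A N) \<and>
     quotient_map G A N (integer_mod_group u \<times>\<times> integer_mod_group (rel_exp G A N)) \<alpha>"
proof -
  have grp: "group G" by (simp add: G_def DirProd_group)
  have com: "comm_group G"
    by (rule group.group_comm_groupI[OF grp]) (auto simp: G_def add.commute)
  have finG: "finite (carrier G)" using assms finite_carrier_integer_mod_group by (simp add: G_def)
  obtain x where x: "x \<in> factor_tuples m n" "A \<in> pair_class m n x"
    using pair_class_exists[OF assms(1,2)] assms(4) unfolding G_def by blast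
  obtain x1 x2 x3 x4 x5 where xx: "x = (x1, x2, x3, x4, x5)" by (cases x)
  obtain a b where ab: "pair_generates G A a b"
    using pair_class_invariants(4)[OF x[unfolded xx]] unfolding G_def by blast
  have finA: "finite A" using finite_subset[OF subgroup.subset[OF assms(4)] finG] .
  obtain u v \<alpha> where uv: "0 < u" "0 < v" "u dvd v" "card A = u * v * card N"
    and \<alpha>: "quotient_map G A N (integer_mod_group u \<times>\<times> integer_mod_group v) \<alpha>"
    using quotient_map_pair_exists[OF com assms(4-6) finA ab] by blast
  have W: "group (integer_mod_group u \<times>\<times> integer_mod_group v)" by (simp add: DirProd_group)
  have re: "relative_exponent G A N v"
    using relative_exponent_quotient_map[OF grp W assms(4) \<alpha> integer_mod_group_pair_exponent[OF uv(1-3)]] .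
  then have "rel_exp G A N = v" by (rule rel_exp_eq)
  then show ?thesis using uv re \<alpha> by blast
qed

text \<open>The arguments after k are |A|, |N| and the exponent of A/N, followed by the same data
  for B and M. The product a m is the order of every subgroup in the class, and a div (n e) is the
  first cyclic factor of the quotient; the value 0 stands for a class without members of order
  k.\<close>

definition Goursat_count :: "nat \<Rightarrow> nat \<Rightarrow> nat \<Rightarrow> nat \<Rightarrow> nat \<Rightarrow> nat \<Rightarrow> nat \<Rightarrow> nat" where
  "Goursat_count k a n e b m e' =
     (if a * m = k \<and> a div (n * e) = b div (m * e') \<and> e = e' then num_auts (a div (n * e)) e else 0)"

text \<open>A member of the class forces equal exponents, and by |A| |M| = |B| |N| also equal first
  factors. If these agree, both quotients map to one group, and the class has as many members as
  that group has automorphisms.\<close>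

lemma card_pair_Goursat_class:
  assumes pos: "0 < m" "0 < n" "0 < r" "0 < s"
  defines "G \<equiv> integer_mod_group m \<times>\<times> integer_mod_group n"
    and "H \<equiv> integer_mod_group r \<times>\<times> integer_mod_group s"
  assumes A: "subgroup A G" "subgroup N G" "N \<subseteq> A" and B: "subgroup B H" "subgroup M H" "M \<subseteq> B"
  shows "card {K \<in> Goursat_class G H A N B M. card K = k} =
    Goursat_count k (card A) (card N) (rel_exp G A N) (card B) (card M) (rel_exp H B M)"
proof -
  have gr: "group G" "group H" by (simp_all add: G_def H_def DirProd_group)
  have fin: "finite (carrier G)" "finite (carrier H)"
    using pos finite_carrier_integer_mod_group by (simp_all add: G_def H_def)
  let ?v = "rel_exp G A N" and ?v' = "rel_exp H B M"
  obtain u \<alpha> where u: "0 < u" "0 < ?v" "card A = u * ?v * card N" "relative_exponent G A N ?v"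
    and \<alpha>: "quotient_map G A N (integer_mod_group u \<times>\<times> integer_mod_group ?v) \<alpha>"
    using pair_quotient[OF pos(1,2) A[unfolded G_def]] unfolding G_def by blast
  obtain u' \<beta> where u': "0 < u'" "0 < ?v'" "card B = u' * ?v' * card M" "relative_exponent H B M ?v'"
    and \<beta>: "quotient_map H B M (integer_mod_group u' \<times>\<times> integer_mod_group ?v') \<beta>"
    using pair_quotient[OF pos(3,4) B[unfolded H_def]] unfolding H_def by blast
  have "finite N" "finite M" "N \<noteq> {}" "M \<noteq> {}"
    using finite_subset[OF subgroup.subset fin(1)] finite_subset[OF subgroup.subset fin(2)] A(2) B(2)
      subgroup.one_closed by blast+
  then have NM: "0 < card N" "0 < card M" by (simp_all add: card_gt_0_iff)
  have udiv: "card A div (card N * ?v) = u" "card B div (card M * ?v') = u'"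
    using u(2,3) u'(2,3) NM by (simp_all add: mult_ac)
  have cardK: "card K = card A * card M" "card K = card B * card N" if "K \<in> Goursat_class G H A N B M" for K
    using that card_subgroup_DirProd[OF gr _ fin, of K] card_subgroup_DirProd'[OF gr _ fin, of K]
    by (auto simp: Goursat_class_def)
  show ?thesis
  proof (cases "card A * card M = k \<and> u = u' \<and> ?v = ?v'")
    case True
    \<comment> \<open>Equality of the numbers lets \<open>\<beta>\<close> be read as a map to the
      group chosen for A/N.\<close>
    then have W: "quotient_map H B M (integer_mod_group u \<times>\<times> integer_mod_group ?v) \<beta>" using \<beta> by simp
    have "{K \<in> Goursat_class G H A N B M. card K = k} = Goursat_class G H A N B M"
      using cardK True by auto
    moreover have "card (Goursat_class G H A N B M) = num_auts u ?v"
      unfolding num_auts_def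
      by (rule card_Goursat_class[OF gr _ A(1) B(1) \<alpha> W]) (simp add: DirProd_group)
    ultimately show ?thesis using True udiv by (simp add: Goursat_count_def)
  next
    case False
    have "{K \<in> Goursat_class G H A N B M. card K = k} = {}"
    proof (rule ccontr)
      assume "{K \<in> Goursat_class G H A N B M. card K = k} \<noteq> {}"
      then obtain K where K: "K \<in> Goursat_class G H A N B M" "card K = k" by blast
      then have K': "subgroup K (G \<times>\<times> H)" "Domain K = A" "K\<inverse> `` {\<one>\<^bsub>H\<^esub>} = N" "Range K = B" "K `` {\<one>\<^bsub>G\<^esub>} = M"
        by (auto simp: Goursat_class_def)
      have "relative_exponent H B M ?v"
        using relative_exponent_Goursat[OF gr K'(1), of ?v] u(4) K'(2-5) by simp
      then have v: "?v = ?v'" using u'(4) relative_exponent_unique by blast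
      have "card A * card M = card B * card N" using cardK[OF K(1)] by simp
      then have "u * (?v * card N * card M) = u' * (?v * card N * card M)"
        unfolding u(3) u'(3) v by (simp add: mult_ac)
      then have "u = u'" using u(2) NM by simp
      then show False using False v cardK[OF K(1)] K(2) by simp
    qed
    then have "card {K \<in> Goursat_class G H A N B M. card K = k} = 0" by (simp only: card.empty)
    then show ?thesis using False udiv by (auto simp: Goursat_count_def)
  qed
qed

text \<open>The subgroups are sorted by their projections and slices; each fibre of this map is the
  part of a Goursat class that has order k.\<close>

lemma card_subgroups_DirProd_pairs:
  assumes pos: "0 < m" "0 < n" "0 < r" "0 < s"
  defines "G \<equiv> integer_mod_group m \<times>\<times> integer_mod_group n"
    and "H \<equiv> integer_mod_group r \<times>\<times> integer_mod_group s"
  shows "card {K. subgroup K (G \<times>\<times> H) \<and> card K = k} =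
    (\<Sum>(A, N)\<in>{(A, N). subgroup A G \<and> subgroup N G \<and> N \<subseteq> A}.
     \<Sum>(B, M)\<in>{(B, M). subgroup B H \<and> subgroup M H \<and> M \<subseteq> B}.
       Goursat_count k (card A) (card N) (rel_exp G A N) (card B) (card M) (rel_exp H B M))"
proof -
  have gr: "group G" "group H" by (simp_all add: G_def H_def DirProd_group)
  have fin: "finite (carrier G)" "finite (carrier H)"
    using pos finite_carrier_integer_mod_group by (simp_all add: G_def H_def)
  let ?P = "{(A, N). subgroup A G \<and> subgroup N G \<and> N \<subseteq> A}"
  let ?Q = "{(B, M). subgroup B H \<and> subgroup M H \<and> M \<subseteq> B}"
  let ?S = "{K. subgroup K (G \<times>\<times> H) \<and> card K = k}"
  define dat where "dat = (\<lambda>K. ((Domain K, K\<inverse> `` {\<one>\<^bsub>H\<^esub>}), (Range K, K `` {\<one>\<^bsub>G\<^esub>})))"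
  have finP: "finite ?P"
    by (rule finite_subset[of _ "{A. subgroup A G} \<times> {A. subgroup A G}"])
       (use finite_subgroups[OF fin(1)] in auto)
  have finQ: "finite ?Q"
    by (rule finite_subset[of _ "{A. subgroup A H} \<times> {A. subgroup A H}"])
       (use finite_subgroups[OF fin(2)] in auto)
  have finS: "finite ?S"
    by (rule finite_subset[of _ "{K. subgroup K (G \<times>\<times> H)}"])
       (use finite_subgroups[of "G \<times>\<times> H"] fin in auto)
  have img: "dat ` ?S \<subseteq> ?P \<times> ?Q"
    using subgroup_Domain[OF gr] subgroup_Range[OF gr] subgroup_Image_one[OF gr]
      subgroup_Image_converse_one[OF gr] by (auto simp: dat_def)
  have "card ?S = (\<Sum>p\<in>?P \<times> ?Q. card {K \<in> ?S. dat K = p})"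
    using sum.group[OF finS finite_cartesian_product[OF finP finQ] img, of "\<lambda>_. 1::nat"] by simp
  also have "\<dots> = (\<Sum>p\<in>?P. \<Sum>q\<in>?Q. card {K \<in> ?S. dat K = (p, q)})"
    by (simp add: sum.cartesian_product)
  also have "\<dots> = (\<Sum>(A, N)\<in>?P. \<Sum>(B, M)\<in>?Q.
      Goursat_count k (card A) (card N) (rel_exp G A N) (card B) (card M) (rel_exp H B M))"
  proof (intro sum.cong refl, clarify, intro sum.cong refl, clarify)
    fix A N B M assume A: "subgroup A G" "subgroup N G" "N \<subseteq> A" and B: "subgroup B H" "subgroup M H" "M \<subseteq> B"
    have "{K \<in> ?S. dat K = ((A, N), (B, M))} = {K \<in> Goursat_class G H A N B M. card K = k}"
      by (auto simp: dat_def Goursat_class_def)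
    then show "card {K \<in> ?S. dat K = ((A, N), (B, M))} =
        Goursat_count k (card A) (card N) (rel_exp G A N) (card B) (card M) (rel_exp H B M)"
      using card_pair_Goursat_class[OF pos A[unfolded G_def] B[unfolded H_def], of k, folded G_def H_def] by simp
  qed
  finally show ?thesis .
qed

section \<open>Rebracketing the four factors and collecting the conditions\<close>

lemma card_subgroups_of_order:
  assumes "finite (carrier G)"
  shows "card {K. subgroup K G \<and> card K = k} = (\<Sum>K\<in>{K. subgroup K G}. if card K = k then 1 else 0)"
  using sum.inter_filter[OF finite_subgroups[OF assms], of "\<lambda>_. 1::nat" "\<lambda>K. card K = k"] by simp

text \<open>The product of four factors associates to the right, while Goursat's lemma is to be
  applied to two pairs. Rebracketing is an isomorphism, so it preserves the number of subgroups of
  each order.\<close>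

lemma num_subgroups_regroup:
  assumes "0 < m" "0 < n" "0 < r" "0 < s"
  shows "num_subgroups m n r s k =
   card {K. subgroup K ((integer_mod_group m \<times>\<times> integer_mod_group n) \<times>\<times>
                        (integer_mod_group r \<times>\<times> integer_mod_group s)) \<and> card K = k}"
proof -
  let ?G = "integer_mod_group m \<times>\<times> integer_mod_group n \<times>\<times> integer_mod_group r \<times>\<times> integer_mod_group s"
  let ?W = "(integer_mod_group m \<times>\<times> integer_mod_group n) \<times>\<times> (integer_mod_group r \<times>\<times> integer_mod_group s)"
  let ?f = "\<lambda>(a::int, b::int, c::int, d::int). ((a, b), (c, d))"
  have gr: "group ?G" "group ?W" by (simp_all add: DirProd_group)
  have fin: "finite (carrier ?G)" "finite (carrier ?W)"
    using assms by (simp_all add: finite_carrier_integer_mod_group)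
  have "quotient_map ?G (carrier ?G) {\<one>\<^bsub>?G\<^esub>} ?W ?f"
    by (auto simp: quotient_map_def image_iff)
  \<comment> \<open>The transported weight is the indicator of order k and ignores the
    exponent.\<close>
  note sum_subgroups_isomorphic[OF gr group.subgroup_self[OF gr(1)] this, of "\<lambda>c e. if c = k then 1::nat else 0"]
  moreover have "{K. subgroup K ?G \<and> K \<subseteq> carrier ?G} = {K. subgroup K ?G}"
    using subgroup.subset by blast
  ultimately show ?thesis
    unfolding num_subgroups_def card_subgroups_of_order[OF fin(1)] card_subgroups_of_order[OF fin(2)] by simp
qed

text \<open>Here |A| = gcd(x1, x4) x3 lcm(x1, x4) is rewritten in the y's. Division by |N| and by
  the exponent leaves y2 y5 / lcm(y2, y5), the first factor u of the quotient.\<close>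

lemma pair_tuples_index:
  assumes "((x1, x2, x3, x4, x5), (y1, y2, y3, y4, y5)) \<in> pair_tuples m n"
  shows "x1 * x3 * x4 div (y1 * y3 * y4 * (y3 * lcm y2 y5)) = gcd y2 y5"
proof -
  have y: "(y1, y2, y3, y4, y5) \<in> factor_tuples (gcd x1 x4) (x3 * lcm x1 x4)"
    using assms by (simp add: pair_tuples_def)
  note Y = factor_tuplesD[OF y]
  have "x1 * x3 * x4 = gcd x1 x4 * (x3 * lcm x1 x4)"
    using prod_gcd_lcm_nat[of x1 x4] by (metis mult.assoc mult.left_commute)
  also have "\<dots> = (y1 * y2 * y3) * (y3 * y4 * y5)" using Y(6,7) by simp
  also have "\<dots> = y1 * y3 * y4 * y3 * (y2 * y5)" by (simp add: mult_ac)
  also have "y2 * y5 = lcm y2 y5 * gcd y2 y5" using prod_gcd_lcm_nat[of y2 y5] by (simp only: mult.commute)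
  finally have "x1 * x3 * x4 = (y1 * y3 * y4 * (y3 * lcm y2 y5)) * gcd y2 y5" by (simp only: mult.assoc)
  moreover have "y1 * y3 * y4 * (y3 * lcm y2 y5) \<noteq> 0" using Y(1-5) by simp
  ultimately show ?thesis by (metis nonzero_mult_div_cancel_left)
qed

theorem theorem6:
  fixes k m n r s :: nat
  assumes "k \<ge> 1" and "m \<ge> 1" and "n \<ge> 1" and "r \<ge> 1" and "s \<ge> 1"
    and "k dvd m * n * r * s"
  shows "num_subgroups m n r s k =
    (\<Sum>((x1, x2, x3, x4, x5), (y1, y2, y3, y4, y5), (z1, z2, z3, z4, z5), (t1, t2, t3, t4, t5))
       \<in> {((x1, x2, x3, x4, x5), (y1, y2, y3, y4, y5), (z1, z2, z3, z4, z5), (t1, t2, t3, t4, t5)).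
           0 \<notin> {x1, x2, x3, x4, x5, y1, y2, y3, y4, y5, z1, z2, z3, z4, z5, t1, t2, t3, t4, t5} \<and>
           x1 * x2 * x3 = m \<and>
           x3 * x4 * x5 = n \<and>
           y1 * y2 * y3 = gcd x1 x4 \<and>
           y3 * y4 * y5 = x3 * lcm x1 x4 \<and>
           z1 * z2 * z3 = r \<and>
           z3 * z4 * z5 = s \<and>
           t1 * t2 * t3 = gcd z1 z4 \<and>
           t3 * t4 * t5 = z3 * lcm z1 z4 \<and>
           gcd y2 y5 = gcd t2 t5 \<and>
           y3 * lcm y2 y5 = t3 * lcm t2 t5 \<and>
           x1 * x3 * x4 * t1 * t3 * t4 = k}.
       totient x3 * totient y3 * totient z3 * totient t3 *
       num_auts (gcd y2 y5) (y3 * lcm y2 y5))"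
  (is "_ = ?rhs")
proof -
  have pos: "0 < m" "0 < n" "0 < r" "0 < s" using assms by auto
  \<comment> \<open>Only conditions (9), (10) and (11) couple the two halves; the other eight are
    built into \<open>pair_tuples\<close>.\<close>
  define c where "c = (\<lambda>(((x1, x2::nat, x3, x4, x5::nat), (y1::nat, y2, y3, y4::nat, y5)),
      ((z1::nat, z2::nat, z3::nat, z4::nat, z5::nat), (t1, t2, t3, t4, t5))).
    gcd y2 y5 = gcd t2 t5 \<and> y3 * lcm y2 y5 = t3 * lcm t2 t5 \<and> x1 * x3 * x4 * t1 * t3 * t4 = (k::nat))"
  define w where "w = (\<lambda>(((x1::nat, x2::nat, x3, x4::nat, x5::nat), (y1::nat, y2, y3, y4::nat, y5)),
      ((z1::nat, z2::nat, z3, z4::nat, z5::nat), (t1::nat, t2::nat, t3, t4::nat, t5::nat))).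
    totient x3 * totient y3 * totient z3 * totient t3 * num_auts (gcd y2 y5) (y3 * lcm y2 y5))"
  define G where "G = integer_mod_group m \<times>\<times> integer_mod_group n"
  define H where "H = integer_mod_group r \<times>\<times> integer_mod_group s"
  let ?Q = "{(B, M). subgroup B H \<and> subgroup M H \<and> M \<subseteq> B}"
  let ?P = "{(A, N). subgroup A G \<and> subgroup N G \<and> N \<subseteq> A}"
  \<comment> \<open>The inner sum depends on (A, N) only through three numbers. As a function of
    these it is a legitimate f for the summation over the first half.\<close>
  define g where "g = (\<lambda>a n e. \<Sum>(B, M)\<in>?Q. Goursat_count k a n e (card B) (card M) (rel_exp H B M))"
  have g: "g a n e = (\<Sum>((z1, z2, z3, z4, z5), (t1, t2, t3, t4, t5))\<in>pair_tuples r s.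
      totient z3 * totient t3 * Goursat_count k a n e (z1 * z3 * z4) (t1 * t3 * t4) (t3 * lcm t2 t5))" for a n e
    unfolding g_def H_def by (rule sum_subgroup_pairs_pair_tuples[OF pos(3,4), of "Goursat_count k a n e"])
  have "num_subgroups m n r s k = (\<Sum>(A, N)\<in>?P. g (card A) (card N) (rel_exp G A N))"
    unfolding num_subgroups_regroup[OF pos] g_def G_def H_def by (rule card_subgroups_DirProd_pairs[OF pos])
  also have "\<dots> = (\<Sum>((x1, x2, x3, x4, x5), (y1, y2, y3, y4, y5))\<in>pair_tuples m n.
        totient x3 * totient y3 * g (x1 * x3 * x4) (y1 * y3 * y4) (y3 * lcm y2 y5))"
    unfolding G_def by (rule sum_subgroup_pairs_pair_tuples[OF pos(1,2)])
  also have "\<dots> = (\<Sum>p\<in>pair_tuples m n. \<Sum>q\<in>pair_tuples r s. if c (p, q) then w (p, q) else 0)"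
  proof (rule sum.cong[OF refl], clarify)
    fix x1 x2 x3 x4 x5 y1 y2 y3 y4 y5
    assume xy: "((x1, x2, x3, x4, x5), (y1, y2, y3, y4, y5)) \<in> pair_tuples m n"
    let ?p = "((x1, x2, x3, x4, x5), (y1, y2, y3, y4, y5))"
    show "totient x3 * totient y3 * g (x1 * x3 * x4) (y1 * y3 * y4) (y3 * lcm y2 y5) =
      (\<Sum>q\<in>pair_tuples r s. if c (?p, q) then w (?p, q) else 0)"
      unfolding g sum_distrib_left
    proof (rule sum.cong[OF refl], clarify)
      fix z1 z2 z3 z4 z5 t1 t2 t3 t4 t5
      assume zt: "((z1, z2, z3, z4, z5), (t1, t2, t3, t4, t5)) \<in> pair_tuples r s"
      let ?q = "((z1, z2, z3, z4, z5), (t1, t2, t3, t4, t5))"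
      show "totient x3 * totient y3 * (totient z3 * totient t3 *
          Goursat_count k (x1 * x3 * x4) (y1 * y3 * y4) (y3 * lcm y2 y5) (z1 * z3 * z4) (t1 * t3 * t4) (t3 * lcm t2 t5)) =
        (if c (?p, ?q) then w (?p, ?q) else 0)"
        \<comment> \<open>The index computation for both tuples turns the two quotients in
          \<open>Goursat_count\<close> into gcd(y2, y5) and gcd(t2, t5), so that its case
          distinction becomes \<open>c\<close>.\<close>
        unfolding Goursat_count_def pair_tuples_index[OF xy] pair_tuples_index[OF zt] c_def w_def prod.case
        by (auto simp: mult.assoc)
    qed
  qed
  also have "\<dots> = (\<Sum>p\<in>pair_tuples m n \<times> pair_tuples r s. if c p then w p else 0)"
    unfolding sum.cartesian_product by (rule sum.cong[OF refl]) (simp only: split_paired_all prod.case)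
  also have "\<dots> = sum w {p \<in> pair_tuples m n \<times> pair_tuples r s. c p}"
    by (rule sum.inter_filter[symmetric]) (simp add: finite_pair_tuples pos)
  also have "\<dots> = ?rhs"
    by (rule sum.reindex_bij_witness[of _ "\<lambda>(x, y, z, t). ((x, y), (z, t))" "\<lambda>((x, y), (z, t)). (x, y, z, t)"])
       (auto simp: pair_tuples_def factor_tuples_def c_def w_def)
  finally show ?thesis .
qed

end
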